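(* Let $A_1,A_2,\ldots$ be independent $d\times d$ complex Gaussian matrices with covariance matrix $\Sigma_d$, where the eigenvalues of $\Sigma_d$ are $\lambda_i^{(d)}=1$ for $i=1,\ldots,d-1$ and $\lambda_d^{(d)}=\theta$, with $\theta>d$. Then the largest Lyapunov exponent $\mu_1$ of the matrices $A_i$ satisfies $$2\mu_1=\log\theta-\gamma+O\left(\frac d\theta\log\theta\right),$$ where $\gamma$ is the Euler constant and the constant implied by the $O(\cdot)$ term is absolute (independent of $d\ge1$ and $\theta>d$).
   Context: Complex Gaussian matrices: for a $d\times d$ positive definite Hermitian matrix $\Sigma$, a $d\times d$ complex Gaussian matrix with covariance matrix $\Sigma$ is a random matrix distributed as $\Sigma^{1/2}G$, where $G$ is a $d\times d$ matrix with independent complex entries, the real and imaginary parts of each entry being independent centered real Gaussian variables with variance $1/2$ (so each entry $g$ of $G$ has $\mathbb E|g|^2=1$). The $A_i$ are independent and identically distributed. Largest Lyapunov exponent: with $P_n:=A_nA_{n-1}\cdots A_1$, it is the (almost sure, deterministic) limit $\mu_1=\lim_{n\to\infty}n^{-1}\log\|P_n\|$, where $\|\cdot\|$ is the operator norm. *)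

theory Defs
  imports
    "HOL-Probability.Probability"
    "Jordan_Normal_Form.Matrix"
    "Jordan_Normal_Form.Char_Poly"
    "Jordan_Normal_Form.Schur_Decomposition"
begin

definition pos_def_hermitian :: "nat \<Rightarrow> complex mat \<Rightarrow> bool" where
  "pos_def_hermitian d S \<longleftrightarrow>
     S \<in> carrier_mat d d \<and> mat_adjoint S = S \<and>
     (\<forall>v \<in> carrier_vec d. v \<noteq> 0\<^sub>v d \<longrightarrow> 0 < Re ((S *\<^sub>v v) \<bullet>c v))"

definition mat_sqrt :: "complex mat \<Rightarrow> complex mat" where
  "mat_sqrt S = (THE R. pos_def_hermitian (dim_row S) R \<and> R * R = S)"

text \<open>The sigma algebra on the \<open>d \<times> d\<close> complex matrices generated by the entries, that is, the
  Borel sigma algebra of the \<open>d\<^sup>2\<close>-dimensional complex space.\<close>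

definition mat_borel :: "nat \<Rightarrow> complex mat measure" where
  "mat_borel d =
     vimage_algebra (carrier_mat d d)
       (\<lambda>A. \<lambda>ij\<in>{..<d} \<times> {..<d}. A $$ ij)
       (Pi\<^sub>M ({..<d} \<times> {..<d}) (\<lambda>_. borel))"

text \<open>Note that \<^const>\<open>normal_density\<close> takes the standard deviation, not the variance, as its
  second argument.\<close>

definition real_gaussian_half :: "real measure" where
  "real_gaussian_half = density lborel (normal_density 0 (sqrt (1 / 2)))"

definition std_complex_gaussian :: "complex measure" where
  "std_complex_gaussian =
     distr (real_gaussian_half \<Otimes>\<^sub>M real_gaussian_half) borel (\<lambda>(x, y). Complex x y)"

text \<open>The law of \<open>S\<^sup>1\<^sup>/\<^sup>2 G\<close>, where \<open>G\<close> has independent standard complex Gaussian entries.\<close>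

definition complex_gaussian_mat :: "nat \<Rightarrow> complex mat \<Rightarrow> complex mat measure" where
  "complex_gaussian_mat d S =
     distr (Pi\<^sub>M ({..<d} \<times> {..<d}) (\<lambda>_. std_complex_gaussian)) (mat_borel d)
       (\<lambda>g. mat_sqrt S * mat d d g)"

text \<open>Sequences of random matrices are indexed from \<open>0\<close>, so that \<open>A i\<close> plays the role of
  \<open>A\<^sub>i\<^sub>+\<^sub>1\<close>.\<close>

definition iid_mats :: "nat \<Rightarrow> complex mat measure \<Rightarrow> 'w measure \<Rightarrow> (nat \<Rightarrow> 'w \<Rightarrow> complex mat) \<Rightarrow> bool"
  where
  "iid_mats d N M A \<longleftrightarrow>
     prob_space M \<and>
     prob_space.indep_vars M (\<lambda>_. mat_borel d) A UNIV \<and>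
     (\<forall>i. distr M (mat_borel d) (A i) = N)"

definition op_norm :: "complex mat \<Rightarrow> real" where
  "op_norm A =
     (SUP v \<in> {v \<in> carrier_vec (dim_col A). L2_set (\<lambda>i. cmod (vec_index v i)) {..<dim_col A} \<le> 1}.
        L2_set (\<lambda>i. cmod (vec_index (A *\<^sub>v v) i)) {..<dim_row A})"

fun mat_seq_prod :: "nat \<Rightarrow> (nat \<Rightarrow> complex mat) \<Rightarrow> nat \<Rightarrow> complex mat" where
  "mat_seq_prod d B 0 = 1\<^sub>m d"
| "mat_seq_prod d B (Suc n) = B n * mat_seq_prod d B n"

definition is_top_lyapunov ::
  "nat \<Rightarrow> 'w measure \<Rightarrow> (nat \<Rightarrow> 'w \<Rightarrow> complex mat) \<Rightarrow> real \<Rightarrow> bool" where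
  "is_top_lyapunov d M A \<mu> \<longleftrightarrow>
     (AE \<omega> in M.
        (\<lambda>n. ln (op_norm (mat_seq_prod d (\<lambda>i. A i \<omega>) n)) / real n) \<longlonglongrightarrow> \<mu>)"

text \<open>The canonical model of an i.i.d. sequence with law \<open>N\<close>: the coordinate maps
  \<open>\<lambda>i \<omega>. \<omega> i\<close> on this space. Stating that the limit exists there fixes the value of
  the exponent without reference to the type of the sample space.\<close>

definition canonical_space :: "complex mat measure \<Rightarrow> (nat \<Rightarrow> complex mat) measure" where
  "canonical_space N = Pi\<^sub>M UNIV (\<lambda>_. N)"

end

theory Submission
  imports Defs
begin

text \<open>For a fixed unit vector \<open>v\<close>, the law \<open>\<rho>\<close> of \<open>|A v|\<^sup>2\<close> under one factor \<open>A = \<Sigma>\<^sup>1\<^sup>/\<^sup>2 G\<close> does not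
  depend on \<open>v\<close>: it is the law of \<open>\<theta> x + s\<close>, where \<open>x\<close> is exponential and \<open>s\<close> is an independent
  Gamma variable of shape \<open>d - 1\<close>. This is read off the Laplace transform, since \<open>\<Sigma>\<close> is the identity
  plus \<open>\<theta> - 1\<close> times a projection of rank one. Consequently the moments satisfy
  \<open>E |P\<^sub>n v|\<^sup>2\<^sup>t = (\<integral> x powr t d\<rho>) ^ n\<close> for all \<open>t\<close>, and Chernoff bounds for small positive and negative
  \<open>t\<close> together with the Borel-Cantelli lemma give \<open>2 \<mu>\<^sub>1 = \<integral> ln x d\<rho>\<close>; the operator norm is comparable
  to the lengths of the images of the basis vectors.

  As the expectation of \<open>ln x\<close> is \<open>- \<gamma>\<close>, the error is \<open>E (ln (1 + s / (\<theta> x)))\<close>, which is bounded by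
  means of \<open>ln (1 + z) \<le> z powr q / q\<close> with \<open>q = 1 - 1 / (4 ln \<theta>)\<close>.\<close>

subsection \<open>Rank-one perturbations of the identity and their square roots\<close>

text \<open>The successive normalised images of a vector are never shown to be independent.
  Integrating out the newest factor first makes the moments of |P_n v|^2 multiplicative, so no law
  of large numbers enters. The lower tail requires a negative moment of \<open>\<rho>\<close>; the
  order -1/2 is available because \<open>x powr - s\<close> is integrable against
  \<open>exp (- x)\<close> near 0 for \<open>s < 1\<close>. The same threshold is the source of the
  factor \<open>ln \<theta>\<close> in the error. The plain bound \<open>ln (1 + z) \<le> z\<close>
  would call for the mean of 1/x, which is infinite, so the exponent \<open>q\<close> has to stay
  below 1, and the moment of order \<open>- q\<close> costs \<open>1 / (1 - q)\<close>, chosen of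
  size \<open>ln \<theta>\<close>. Another obstacle is the square root. It is a definite
  description, about which nothing is known until existence and uniqueness of the positive root are
  proved. After that, the Laplace transform sees the root R only through R times its adjoint, which
  is explicit in terms of one eigenvector; neither a diagonalisation nor the unitary invariance of G
  is called upon.\<close>

lemma mult_mat_entry:
  assumes "A \<in> carrier_mat n m" "B \<in> carrier_mat m k" "i < n" "j < k"
  shows "(A * B) $$ (i, j) = (\<Sum>l<m. A $$ (i, l) * B $$ (l, j))"
  using assms by (auto simp: scalar_prod_def atLeast0LessThan intro!: sum.cong)

lemma mult_mat_vec_entry:
  assumes "A \<in> carrier_mat n m" "v \<in> carrier_vec m" "i < n"
  shows "(A *\<^sub>v v) $ i = (\<Sum>j<m. A $$ (i, j) * v $ j)"
  using assms by (auto simp: scalar_prod_def atLeast0LessThan intro!: sum.cong)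

lemma mat_adjoint_entry:
  assumes "A \<in> carrier_mat n m" "i < m" "j < n"
  shows "mat_adjoint A $$ (i, j) = cnj (A $$ (j, i))"
  using assms by (auto simp: mat_adjoint_def mat_of_rows_def)

lemma mat_adjoint_carrier:
  assumes "A \<in> carrier_mat n m"
  shows "mat_adjoint A \<in> carrier_mat m n"
  using assms by (auto simp: mat_adjoint_def)

lemma hermitian_entry:
  assumes "A \<in> carrier_mat n n" "mat_adjoint A = A" "i < n" "j < n"
  shows "cnj (A $$ (i, j)) = A $$ (j, i)"
  using mat_adjoint_entry[of A n n j i] assms by simp

lemma conjugate_scalar_prod_self:
  assumes "v \<in> carrier_vec n"
  shows "v \<bullet>c v = complex_of_real (\<Sum>k<n. (cmod (v $ k))\<^sup>2)"
  using assms
  by (auto simp: scalar_prod_def atLeast0LessThan complex_norm_square[symmetric] intro!: sum.cong)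

lemma trace_mult_commute:
  fixes A B :: "'a :: comm_semiring_0 mat"
  assumes "A \<in> carrier_mat n m" "B \<in> carrier_mat m n"
  shows "(\<Sum>i<n. (A * B) $$ (i, i)) = (\<Sum>i<m. (B * A) $$ (i, i))"
proof -
  have "(\<Sum>i<n. (A * B) $$ (i, i)) = (\<Sum>i<n. \<Sum>l<m. A $$ (i, l) * B $$ (l, i))"
    using assms by (intro sum.cong refl mult_mat_entry) auto
  also have "\<dots> = (\<Sum>l<m. \<Sum>i<n. B $$ (l, i) * A $$ (i, l))"
    by (subst sum.swap) (simp add: mult.commute)
  also have "\<dots> = (\<Sum>i<m. (B * A) $$ (i, i))"
    using assms by (intro sum.cong refl mult_mat_entry[symmetric]) auto
  finally show ?thesis .
qed

lemma trace_similar: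
  fixes A B :: "'a :: comm_semiring_1 mat"
  assumes "similar_mat_wit A B P Q" "A \<in> carrier_mat n n"
  shows "(\<Sum>i<n. A $$ (i, i)) = (\<Sum>i<n. B $$ (i, i))"
proof -
  note w = similar_mat_witD2[OF assms(2,1)]
  have "(\<Sum>i<n. A $$ (i, i)) = (\<Sum>i<n. (P * B * Q) $$ (i, i))"
    using w(3) by simp
  also have "\<dots> = (\<Sum>i<n. (Q * (P * B)) $$ (i, i))"
    by (rule trace_mult_commute) (use w in auto)
  also have "Q * (P * B) = Q * P * B"
    by (rule assoc_mult_mat[symmetric]) (use w in auto)
  also have "\<dots> = B"
    using w by simp
  finally show ?thesis .
qed

text \<open>Schur triangularisation makes \<open>A\<close> similar to an upper triangular
  \<open>B\<close> with diagonal \<open>es\<close>. Traces are invariant under similarity, and the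
  same similarity carries \<open>A * A\<close> to \<open>B * B\<close>, whose diagonal consists of
  the squares.\<close>

lemma traces_of_char_poly:
  fixes A :: "complex mat"
  assumes A: "A \<in> carrier_mat n n" and c: "char_poly A = (\<Prod>e \<leftarrow> es. [:- e, 1:])"
  shows "(\<Sum>i<n. A $$ (i, i)) = sum_list es"
    and "(\<Sum>i<n. (A * A) $$ (i, i)) = (\<Sum>e \<leftarrow> es. e * e)"
proof -
  obtain B P Q where "schur_decomposition A es = (B, P, Q)"
    by (metis prod_cases3)
  from schur_decomposition[OF A c this]
  have w: "similar_mat_wit A B P Q" and ut: "upper_triangular B" and dg: "diag_mat B = es"
    by auto
  note wD = similar_mat_witD2[OF A w]
  have B: "B \<in> carrier_mat n n" by (rule wD)
  have len: "length es = n" using dg B by (auto simp: diag_mat_def)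
  have es: "es ! i = B $$ (i, i)" if "i < n" for i
    using that dg B by (auto simp: diag_mat_def)
  have s: "sum_list (map f es) = (\<Sum>i<n. f (B $$ (i, i)))" for f :: "complex \<Rightarrow> complex"
    by (simp add: sum_list_sum_nth len atLeast0LessThan es)
  show "(\<Sum>i<n. A $$ (i, i)) = sum_list es"
    using trace_similar[OF w A] s[of "\<lambda>x. x"] by simp
  have w2: "similar_mat_wit (A * A) (B * B) P Q"
  proof (rule similar_mat_witI[of _ _ n])
    have "A * A = P * B * Q * (P * (B * Q))"
      using wD by simp
    also have "\<dots> = P * B * (Q * (P * (B * Q)))"
      by (rule assoc_mult_mat) (use wD in auto)
    also have "Q * (P * (B * Q)) = Q * P * (B * Q)"
      by (rule assoc_mult_mat[symmetric]) (use wD in auto)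
    also have "Q * P * (B * Q) = B * Q"
      using wD by simp
    also have "P * B * (B * Q) = P * B * B * Q"
      by (rule assoc_mult_mat[symmetric]) (use wD in auto)
    also have "P * B * B = P * (B * B)"
      by (rule assoc_mult_mat) (use wD in auto)
    finally show "A * A = P * (B * B) * Q" .
  qed (use wD in auto)
  have "(B * B) $$ (i, i) = B $$ (i, i) * B $$ (i, i)" if i: "i < n" for i
  proof -
    have "(B * B) $$ (i, i) = (\<Sum>l<n. B $$ (i, l) * B $$ (l, i))"
      by (rule mult_mat_entry) (use B i in auto)
    \<comment> \<open>For \<open>l < i\<close> the factor \<open>B $$ (i, l)\<close> lies below the
      diagonal, for \<open>l > i\<close> the factor \<open>B $$ (l, i)\<close> does.\<close>
    also have "\<dots> = (\<Sum>l<n. if l = i then B $$ (i, i) * B $$ (i, i) else 0)"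
      using ut B i by (intro sum.cong refl) (auto simp: upper_triangular_def not_less neq_iff)
    finally show ?thesis using i by simp
  qed
  then show "(\<Sum>i<n. (A * A) $$ (i, i)) = (\<Sum>e \<leftarrow> es. e * e)"
    using trace_similar[OF w2, of n] A s[of "\<lambda>x. x * x"] by simp
qed

text \<open>Comparing the traces of \<open>A\<close> and \<open>A\<^sup>2\<close> with the eigenvalues shows that
  \<open>A - 1 - (\<theta> - 1) u u\<^sup>*\<close> has Hilbert-Schmidt norm \<open>0\<close>, where \<open>u\<close> is a unit eigenvector for
  \<open>\<theta>\<close>. This replaces the spectral theorem.\<close>

lemma hermitian_rank_one:
  fixes A :: "complex mat" and \<theta> :: real
  assumes A: "A \<in> carrier_mat d d" "mat_adjoint A = A" and d: "d \<ge> 1"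
    and c: "char_poly A = (\<Prod>a \<leftarrow> replicate (d - 1) 1 @ [complex_of_real \<theta>]. [:- a, 1:])"
  obtains u :: "nat \<Rightarrow> complex"
  where "(\<Sum>k<d. (cmod (u k))\<^sup>2) = 1"
    and "\<And>k l. k < d \<Longrightarrow> l < d \<Longrightarrow>
           A $$ (k, l) = of_bool (k = l) + of_real (\<theta> - 1) * u k * cnj (u l)"
proof -
  have "poly (char_poly A) (complex_of_real \<theta>) = 0" by (simp add: c)
  then have "eigenvalue A (complex_of_real \<theta>)" using eigenvalue_root_char_poly[OF A(1)] by simp
  then obtain v where v: "v \<in> carrier_vec d" "v \<noteq> 0\<^sub>v d" "A *\<^sub>v v = complex_of_real \<theta> \<cdot>\<^sub>v v"
    using A by (auto simp: eigenvalue_def eigenvector_def)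
  define N where "N = (\<Sum>k<d. (cmod (v $ k))\<^sup>2)"
  obtain k0 where "k0 < d" "v $ k0 \<noteq> 0" using v by (metis eq_vecI carrier_vecD index_zero_vec)
  then have "N > 0" unfolding N_def by (intro sum_pos2[of _ k0]) auto
  define u where "u k = v $ k / of_real (sqrt N)" for k
  have n1: "(\<Sum>k<d. (cmod (u k))\<^sup>2) = 1"
    using \<open>N > 0\<close> by (simp add: u_def norm_divide power_divide sum_divide_distrib[symmetric] N_def[symmetric])
  have n1': "(\<Sum>k<d. u k * cnj (u k)) = 1"
    using arg_cong[OF n1, of complex_of_real] by (simp only: of_real_sum complex_norm_square of_real_1)
  have ev: "(\<Sum>l<d. A $$ (k, l) * u l) = of_real \<theta> * u k" if "k < d" for k
  proof -
    have "(\<Sum>l<d. A $$ (k, l) * v $ l) = of_real \<theta> * v $ k"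
      using mult_mat_vec_entry[OF A(1) v(1) that] v that by simp
    then show ?thesis by (simp add: u_def sum_divide_distrib[symmetric])
  qed
  note tr = traces_of_char_poly[OF A(1) c]
  have tr1: "(\<Sum>i<d. A $$ (i, i)) = of_nat d - 1 + of_real \<theta>"
    using d by (simp add: tr(1) sum_list_replicate of_nat_diff)
  have tr2: "(\<Sum>k<d. \<Sum>l<d. A $$ (k, l) * A $$ (l, k)) = of_nat d - 1 + of_real \<theta> * of_real \<theta>"
    using d tr(2) by (simp add: sum_list_replicate of_nat_diff map_replicate mult_mat_entry[OF A(1) A(1)])
  have q: "(\<Sum>k<d. \<Sum>l<d. A $$ (k, l) * u l * cnj (u k)) = of_real \<theta>"
  proof -
    have "(\<Sum>k<d. \<Sum>l<d. A $$ (k, l) * u l * cnj (u k)) = (\<Sum>k<d. (of_real \<theta> * u k) * cnj (u k))"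
      by (intro sum.cong refl) (simp add: sum_distrib_right[symmetric] ev)
    also have "\<dots> = of_real \<theta>" by (simp add: mult.assoc sum_distrib_left[symmetric] n1')
    finally show ?thesis .
  qed
  define c where "c = complex_of_real (\<theta> - 1)"
  define T where "T k l = A $$ (k, l) - of_bool (k = l) - c * u k * cnj (u l)" for k l
  have "complex_of_real (\<Sum>k<d. \<Sum>l<d. (cmod (T k l))\<^sup>2) = (\<Sum>k<d. \<Sum>l<d. T k l * cnj (T k l))"
    by (simp only: of_real_sum complex_norm_square)
  \<comment> \<open>The summands are arranged so that each double sum is known: with tr A = d - 1 +
    \<theta>, tr A^2 = d - 1 + \<theta>^2 and the quadratic form of A at u equal to \<theta>, the
    total is (\<theta> - 1 - c)^2, which vanishes.\<close>
  also have "\<dots> = (\<Sum>k<d. \<Sum>l<d. A $$ (k, l) * A $$ (l, k) - of_bool (k = l) * A $$ (k, l)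
      - of_bool (k = l) * A $$ (l, k) + of_bool (k = l) * 1
      - c * (A $$ (k, l) * u l * cnj (u k)) - c * (A $$ (l, k) * u k * cnj (u l))
      + 2 * c * (of_bool (k = l) * (u k * cnj (u l))) + c\<^sup>2 * ((u k * cnj (u k)) * (u l * cnj (u l))))"
    by (intro sum.cong refl)
      (auto simp: T_def hermitian_entry[OF A] c_def algebra_simps power2_eq_square)
  also have "\<dots> = (\<Sum>k<d. \<Sum>l<d. A $$ (k, l) * A $$ (l, k)) - (\<Sum>k<d. A $$ (k, k)) - (\<Sum>k<d. A $$ (k, k))
      + (\<Sum>k<d. 1) - c * (\<Sum>k<d. \<Sum>l<d. A $$ (k, l) * u l * cnj (u k))
      - c * (\<Sum>k<d. \<Sum>l<d. A $$ (l, k) * u k * cnj (u l))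
      + 2 * c * (\<Sum>k<d. u k * cnj (u k)) + c\<^sup>2 * ((\<Sum>k<d. u k * cnj (u k)) * (\<Sum>k<d. u k * cnj (u k)))"
  proof -
    have D: "(\<Sum>k<d. \<Sum>l<d. of_bool (k = l) * f k l) = (\<Sum>k<d. f k k)" for f :: "nat \<Rightarrow> nat \<Rightarrow> complex"
      by (simp add: of_bool_def if_distrib[of "\<lambda>x. x * _"] cong: if_cong)
    show ?thesis
      by (simp only: sum.distrib sum_subtractf sum_distrib_left[symmetric] D
          sum_product[of "\<lambda>k. u k * cnj (u k)" "{..<d}" "\<lambda>k. u k * cnj (u k)" "{..<d}"])
  qed
  also have "(\<Sum>k<d. \<Sum>l<d. A $$ (l, k) * u k * cnj (u l)) = of_real \<theta>"
    by (subst sum.swap) (rule q)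
  also have "(\<Sum>k<d. \<Sum>l<d. A $$ (k, l) * A $$ (l, k)) - (\<Sum>k<d. A $$ (k, k)) - (\<Sum>k<d. A $$ (k, k))
      + (\<Sum>k<d. 1) - c * (\<Sum>k<d. \<Sum>l<d. A $$ (k, l) * u l * cnj (u k)) - c * of_real \<theta>
      + 2 * c * (\<Sum>k<d. u k * cnj (u k)) + c\<^sup>2 * ((\<Sum>k<d. u k * cnj (u k)) * (\<Sum>k<d. u k * cnj (u k))) = 0"
    unfolding tr1 tr2 q n1' by (simp add: c_def algebra_simps power2_eq_square)
  finally have "(\<Sum>k<d. \<Sum>l<d. (cmod (T k l))\<^sup>2) = 0" by (simp only: of_real_eq_0_iff)
  then have "T k l = 0" if "k < d" "l < d" for k l
    using that by (subst (asm) sum_nonneg_eq_0_iff) (auto simp: sum_nonneg_eq_0_iff sum_nonneg)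
  then have "A $$ (k, l) = of_bool (k = l) + of_real (\<theta> - 1) * u k * cnj (u l)" if "k < d" "l < d" for k l
    using that by (simp add: T_def c_def algebra_simps)
  with n1 show ?thesis by (rule that)
qed

text \<open>The vector \<open>w = R v - \<mu> v\<close> satisfies \<open>R w = - \<mu> w\<close>, which positivity of \<open>R\<close> forbids
  unless \<open>w = 0\<close>. Applied to eigenvectors, this yields the uniqueness of the square root.\<close>

lemma pos_def_sqrt_eigenvector:
  assumes R: "pos_def_hermitian n R" and v: "v \<in> carrier_vec n"
    and ev: "R * R *\<^sub>v v = complex_of_real (\<mu>\<^sup>2) \<cdot>\<^sub>v v" and \<mu>: "\<mu> > 0"
  shows "R *\<^sub>v v = complex_of_real \<mu> \<cdot>\<^sub>v v"
proof -
  have C: "R \<in> carrier_mat n n" using R by (simp add: pos_def_hermitian_def)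
  define w where "w = R *\<^sub>v v - complex_of_real \<mu> \<cdot>\<^sub>v v"
  have w: "w \<in> carrier_vec n" using C v by (simp add: w_def)
  have "R *\<^sub>v w = R *\<^sub>v (R *\<^sub>v v) - R *\<^sub>v (complex_of_real \<mu> \<cdot>\<^sub>v v)"
    unfolding w_def by (rule mult_minus_distrib_mat_vec) (use C v in auto)
  also have "\<dots> = complex_of_real (\<mu>\<^sup>2) \<cdot>\<^sub>v v - complex_of_real \<mu> \<cdot>\<^sub>v (R *\<^sub>v v)"
    using assoc_mult_mat_vec[OF C C v] mult_mat_vec[OF C v] ev by simp
  also have "\<dots> = complex_of_real (- \<mu>) \<cdot>\<^sub>v w"
    using C v by (intro eq_vecI) (auto simp: w_def algebra_simps power2_eq_square)
  finally have Rw: "R *\<^sub>v w = complex_of_real (- \<mu>) \<cdot>\<^sub>v w" .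
  have "w = 0\<^sub>v n"
  proof (rule ccontr)
    assume "w \<noteq> 0\<^sub>v n"
    then have "0 < Re ((R *\<^sub>v w) \<bullet>c w)" using R w by (simp add: pos_def_hermitian_def)
    also have "(R *\<^sub>v w) \<bullet>c w = complex_of_real (- \<mu> * (\<Sum>k<n. (cmod (w $ k))\<^sup>2))"
      using w by (simp add: Rw conjugate_scalar_prod_self smult_scalar_prod_distrib[of _ n])
    also have "Re \<dots> \<le> 0" using \<mu> by (simp add: sum_nonneg)
    finally show False by simp
  qed
  then have "w $ i = 0" if "i < n" for i using that by simp
  then show ?thesis using C v by (intro eq_vecI) (auto simp: w_def)
qed

text \<open>To evaluate the definite description \<open>mat_sqrt\<close>, a root is exhibited and
  shown to be unique. The candidate is the identity plus \<open>sqrt \<theta> - 1\<close> times the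
  projection onto \<open>u\<close>. Any positive root must multiply \<open>u\<close> by
  \<open>sqrt \<theta>\<close> and fix the orthogonal complement of \<open>u\<close>, hence equals
  it.\<close>

lemma mat_sqrt_rank_one:
  fixes A :: "complex mat" and u :: "nat \<Rightarrow> complex"
  assumes A: "A \<in> carrier_mat d d" and \<theta>: "\<theta> > 1" and n1: "(\<Sum>k<d. (cmod (u k))\<^sup>2) = 1"
    and AA: "\<And>k l. k < d \<Longrightarrow> l < d \<Longrightarrow>
           A $$ (k, l) = of_bool (k = l) + of_real (\<theta> - 1) * u k * cnj (u l)"
  shows "pos_def_hermitian d (mat_sqrt A) \<and> mat_sqrt A * mat_sqrt A = A"
proof -
  have n1': "(\<Sum>k<d. u k * cnj (u k)) = 1"
    using arg_cong[OF n1, of complex_of_real] by (simp only: of_real_sum complex_norm_square of_real_1)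
  \<comment> \<open>As \<open>u\<close> has length 1, adding b times its projection to the identity
    and squaring adds b^2 + 2 b times the projection; b is the positive solution of b^2 + 2 b =
    \<theta> - 1.\<close>
  define b where "b = sqrt \<theta> - 1"
  have b: "b > 0" "b * b + 2 * b = \<theta> - 1" using \<theta> by (simp_all add: b_def algebra_simps)
  have b': "complex_of_real b * of_real b + 2 * of_real b = of_real (\<theta> - 1)"
    using arg_cong[OF b(2), of complex_of_real] by simp
  define R where "R = mat d d (\<lambda>(k, l). of_bool (k = l) + of_real b * u k * cnj (u l))"
  have RC: "R \<in> carrier_mat d d" by (simp add: R_def)
  have RR: "R * R = A"
  proof (rule eq_matI)
    fix k l assume kl: "k < dim_row A" "l < dim_col A"
    then have kl: "k < d" "l < d" using A by auto
    have "(R * R) $$ (k, l) = (\<Sum>j<d. R $$ (k, j) * R $$ (j, l))"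
      by (rule mult_mat_entry[OF RC RC]) (use kl in auto)
    also have "\<dots> = (\<Sum>j<d. of_bool (k = j) * of_bool (j = l) + of_real b * u k * (of_bool (j = l) * cnj (u j))
        + of_real b * cnj (u l) * (of_bool (k = j) * u j) + of_real b * of_real b * u k * cnj (u l) * (u j * cnj (u j)))"
      using kl by (intro sum.cong refl) (auto simp: R_def algebra_simps)
    also have "\<dots> = of_bool (k = l) + of_real b * u k * cnj (u l) + of_real b * cnj (u l) * u k
        + of_real b * of_real b * u k * cnj (u l)"
      using kl by (simp add: sum.distrib sum_distrib_left[symmetric] n1' of_bool_def
        if_distrib[of "\<lambda>x. x * _"] cong: if_cong)
    also have "\<dots> = of_bool (k = l) + (complex_of_real b * of_real b + 2 * of_real b) * u k * cnj (u l)"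
      by (simp add: algebra_simps)
    finally show "(R * R) $$ (k, l) = A $$ (k, l)" by (simp add: b' AA kl)
  qed (use A RC in auto)
  have Rpd: "pos_def_hermitian d R"
    unfolding pos_def_hermitian_def
  proof (intro conjI ballI impI)
    show "mat_adjoint R = R"
    proof (rule eq_matI)
      fix k l assume "k < dim_row R" "l < dim_col R"
      then have kl: "k < d" "l < d" by (auto simp: R_def)
      show "mat_adjoint R $$ (k, l) = R $$ (k, l)"
        unfolding mat_adjoint_entry[OF RC kl] using kl by (simp add: R_def)
    qed (use mat_adjoint_carrier[OF RC] RC in auto)
    fix v :: "complex vec" assume v: "v \<in> carrier_vec d" "v \<noteq> 0\<^sub>v d"
    define s where "s = (\<Sum>l<d. cnj (u l) * v $ l)"
    have "(R *\<^sub>v v) $ k = v $ k + of_real b * u k * s" if "k < d" for k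
    proof -
      have "(R *\<^sub>v v) $ k = (\<Sum>l<d. of_bool (k = l) * v $ l + of_real b * u k * (cnj (u l) * v $ l))"
        unfolding mult_mat_vec_entry[OF RC v(1) that]
        by (intro sum.cong refl) (use that in \<open>auto simp: R_def algebra_simps\<close>)
      also have "\<dots> = v $ k + of_real b * u k * s"
        using that by (simp add: sum.distrib sum_distrib_left[symmetric] s_def of_bool_def
          if_distrib[of "\<lambda>x. x * _"] cong: if_cong)
      finally show ?thesis .
    qed
    then have "(R *\<^sub>v v) \<bullet>c v = (\<Sum>k<d. (v $ k + of_real b * u k * s) * cnj (v $ k))"
      using RC v by (auto simp: scalar_prod_def atLeast0LessThan intro!: sum.cong)
    also have "\<dots> = (\<Sum>k<d. v $ k * cnj (v $ k)) + of_real b * s * (\<Sum>k<d. cnj (cnj (u k) * v $ k))"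
      by (simp add: algebra_simps sum.distrib sum_distrib_left)
    also have "(\<Sum>k<d. cnj (cnj (u k) * v $ k)) = cnj s" by (simp add: s_def)
    also have "(\<Sum>k<d. v $ k * cnj (v $ k)) + of_real b * s * cnj s
        = of_real ((\<Sum>k<d. (cmod (v $ k))\<^sup>2) + b * (cmod s)\<^sup>2)"
      by (simp only: of_real_add of_real_sum of_real_mult complex_norm_square mult.assoc)
    finally have e: "Re ((R *\<^sub>v v) \<bullet>c v) = (\<Sum>k<d. (cmod (v $ k))\<^sup>2) + b * (cmod s)\<^sup>2" by simp
    obtain k0 where "k0 < d" "v $ k0 \<noteq> 0" using v by (metis eq_vecI carrier_vecD index_zero_vec)
    then have "(\<Sum>k<d. (cmod (v $ k))\<^sup>2) > 0" by (intro sum_pos2[of _ k0]) auto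
    then show "0 < Re ((R *\<^sub>v v) \<bullet>c v)" using b by (simp add: e add_pos_nonneg)
  qed (rule RC)
  have uniq: "S = R" if S: "pos_def_hermitian d S" "S * S = A" for S
  proof -
    have SC: "S \<in> carrier_mat d d" using S by (simp add: pos_def_hermitian_def)
    have Av: "(A *\<^sub>v v) $ k = v $ k + of_real (\<theta> - 1) * u k * (\<Sum>l<d. cnj (u l) * v $ l)"
      if "k < d" "v \<in> carrier_vec d" for v k
    proof -
      have "(A *\<^sub>v v) $ k = (\<Sum>l<d. of_bool (k = l) * v $ l + of_real (\<theta> - 1) * u k * (cnj (u l) * v $ l))"
        unfolding mult_mat_vec_entry[OF A that(2,1)]
        by (intro sum.cong refl) (use that in \<open>auto simp: AA algebra_simps\<close>)
      also have "\<dots> = v $ k + of_real (\<theta> - 1) * u k * (\<Sum>l<d. cnj (u l) * v $ l)"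
        using that by (simp add: sum.distrib sum_distrib_left[symmetric] of_bool_def
          if_distrib[of "\<lambda>x. x * _"] cong: if_cong)
      finally show ?thesis .
    qed
    have n1'': "(\<Sum>k<d. cnj (u k) * u k) = 1" using n1' by (simp add: mult.commute)
    define U where "U = vec d u"
    have U: "U \<in> carrier_vec d" by (simp add: U_def)
    have "A *\<^sub>v U = complex_of_real ((sqrt \<theta>)\<^sup>2) \<cdot>\<^sub>v U"
    proof (rule eq_vecI)
      fix i assume "i < dim_vec (complex_of_real ((sqrt \<theta>)\<^sup>2) \<cdot>\<^sub>v U)"
      then have i: "i < d" by (simp add: U_def)
      have "(\<Sum>l<d. cnj (u l) * U $ l) = 1" using n1'' by (simp add: U_def)
      then show "(A *\<^sub>v U) $ i = (complex_of_real ((sqrt \<theta>)\<^sup>2) \<cdot>\<^sub>v U) $ i"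
        unfolding Av[OF i U] using i \<theta> by (simp add: U_def algebra_simps)
    qed (use A in \<open>auto simp: U_def\<close>)
    then have SU: "S *\<^sub>v U = complex_of_real (sqrt \<theta>) \<cdot>\<^sub>v U"
      using pos_def_sqrt_eigenvector[of d S U "sqrt \<theta>"] S \<theta> U by simp
    show ?thesis
    proof (rule eq_matI)
      fix k l assume "k < dim_row R" "l < dim_col R"
      then have kl: "k < d" "l < d" by (auto simp: R_def)
      \<comment> \<open>The part of the basis vector \<open>l\<close> orthogonal to
        \<open>U\<close>. It is fixed by \<open>S\<close>, so column \<open>l\<close> of
        \<open>S\<close> is \<open>x\<close> plus \<open>sqrt \<theta> * cnj (u l)\<close> times
        \<open>U\<close>.\<close>
      define x where "x = unit_vec d l - cnj (u l) \<cdot>\<^sub>v U"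
      have x: "x \<in> carrier_vec d" by (simp add: x_def U_def)
      have xj: "x $ j = of_bool (j = l) - cnj (u l) * u j" if "j < d" for j
        using that kl by (auto simp: x_def U_def)
      have "(\<Sum>j<d. cnj (u j) * x $ j) = (\<Sum>j<d. of_bool (j = l) * cnj (u j) - cnj (u l) * (cnj (u j) * u j))"
        by (intro sum.cong refl) (auto simp: xj algebra_simps)
      also have "\<dots> = 0"
        using kl by (simp add: sum_subtractf sum_distrib_left[symmetric] n1'' of_bool_def
          if_distrib[of "\<lambda>x. x * _"] cong: if_cong)
      finally have orth: "(\<Sum>j<d. cnj (u j) * x $ j) = 0" .
      have "A *\<^sub>v x = complex_of_real (1\<^sup>2) \<cdot>\<^sub>v x"
      proof (rule eq_vecI)
        fix i assume "i < dim_vec (complex_of_real (1\<^sup>2) \<cdot>\<^sub>v x)"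
        then have "i < d" using x by simp
        then show "(A *\<^sub>v x) $ i = (complex_of_real (1\<^sup>2) \<cdot>\<^sub>v x) $ i"
          unfolding Av[OF \<open>i < d\<close> x] orth using x by simp
      qed (use A x in auto)
      then have Sx: "S *\<^sub>v x = complex_of_real 1 \<cdot>\<^sub>v x"
        using pos_def_sqrt_eigenvector[of d S x 1] S x by simp
      have "unit_vec d l = x + cnj (u l) \<cdot>\<^sub>v U"
        by (rule eq_vecI) (auto simp: x_def U_def)
      then have "S *\<^sub>v unit_vec d l = S *\<^sub>v x + S *\<^sub>v (cnj (u l) \<cdot>\<^sub>v U)"
        using mult_add_distrib_mat_vec[OF SC x, of "cnj (u l) \<cdot>\<^sub>v U"] U by simp
      also have "\<dots> = x + cnj (u l) \<cdot>\<^sub>v (complex_of_real (sqrt \<theta>) \<cdot>\<^sub>v U)"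
        by (simp add: Sx mult_mat_vec[OF SC U] SU)
      finally have "(S *\<^sub>v unit_vec d l) $ k = x $ k + cnj (u l) * (of_real (sqrt \<theta>) * u k)"
        using kl x by (simp add: U_def del: index_mult_mat_vec)
      moreover have "(S *\<^sub>v unit_vec d l) $ k = S $$ (k, l)"
        using kl SC by (simp add: mult_mat_vec_entry[OF SC] unit_vec_def if_distrib cong: if_cong del: index_mult_mat_vec)
      ultimately show "S $$ (k, l) = R $$ (k, l)"
        using kl by (simp add: xj R_def b_def algebra_simps)
    qed (use SC in \<open>auto simp: R_def\<close>)
  qed
  have "mat_sqrt A = R"
    unfolding mat_sqrt_def carrier_matD(1)[OF A]
  proof (rule the_equality)
    show "pos_def_hermitian d R \<and> R * R = A" by (intro conjI Rpd RR)
    show "S = R" if "pos_def_hermitian d S \<and> S * S = A" for S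
      by (rule uniq[OF conjunct1[OF that] conjunct2[OF that]])
  qed
  show ?thesis
    unfolding \<open>mat_sqrt A = R\<close> by (intro conjI Rpd RR)
qed

text \<open>The root is Hermitian, so its Gram matrix is its square, which is \<open>A\<close>. This
  Gram matrix is the form in which the covariance enters the Gaussian computation.\<close>

lemma mat_sqrt_gram:
  fixes A :: "complex mat" and \<theta> :: real
  assumes A: "pos_def_hermitian d A" and d: "d \<ge> 1" and \<theta>: "\<theta> > 1"
    and c: "char_poly A = (\<Prod>a \<leftarrow> replicate (d - 1) 1 @ [complex_of_real \<theta>]. [:- a, 1:])"
  obtains u :: "nat \<Rightarrow> complex"
  where "mat_sqrt A \<in> carrier_mat d d" "(\<Sum>k<d. (cmod (u k))\<^sup>2) = 1"
    and "\<And>k l. k < d \<Longrightarrow> l < d \<Longrightarrow>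
           (\<Sum>j<d. mat_sqrt A $$ (k, j) * cnj (mat_sqrt A $$ (l, j)))
           = of_bool (k = l) + of_real (\<theta> - 1) * u k * cnj (u l)"
proof -
  have AC: "A \<in> carrier_mat d d" and AH: "mat_adjoint A = A"
    using A by (auto simp: pos_def_hermitian_def)
  obtain u where u: "(\<Sum>k<d. (cmod (u k))\<^sup>2) = 1"
    "\<And>k l. k < d \<Longrightarrow> l < d \<Longrightarrow> A $$ (k, l) = of_bool (k = l) + of_real (\<theta> - 1) * u k * cnj (u l)"
    using hermitian_rank_one[OF AC AH d c] by metis
  let ?R = "mat_sqrt A"
  have R: "pos_def_hermitian d ?R" "?R * ?R = A"
    using mat_sqrt_rank_one[OF AC \<theta> u] by auto
  then have RC: "?R \<in> carrier_mat d d" and RH: "mat_adjoint ?R = ?R"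
    by (auto simp: pos_def_hermitian_def)
  have "(\<Sum>j<d. ?R $$ (k, j) * cnj (?R $$ (l, j))) = A $$ (k, l)" if "k < d" "l < d" for k l
  proof -
    have "(\<Sum>j<d. ?R $$ (k, j) * cnj (?R $$ (l, j))) = (\<Sum>j<d. ?R $$ (k, j) * ?R $$ (j, l))"
      using that by (intro sum.cong refl) (simp add: hermitian_entry[OF RC RH])
    also have "\<dots> = (?R * ?R) $$ (k, l)" by (rule mult_mat_entry[OF RC RC that, symmetric])
    finally show ?thesis by (simp add: R)
  qed
  with u RC show ?thesis by (intro that) auto
qed

subsection \<open>Laplace transforms of Gaussian quadratic forms\<close>

lemma borel_measurable_cnj [measurable]: "cnj \<in> borel_measurable borel"
  by (intro borel_measurable_continuous_onI continuous_intros)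

lemma borel_measurable_Re_cnj_mult:
  assumes "f \<in> borel_measurable M" "g \<in> borel_measurable M"
  shows "(\<lambda>x. Re (cnj (f x) * g x)) \<in> borel_measurable M"
  using assms by measurable


lemma char_normal_density:
  assumes \<sigma>: "\<sigma> > 0"
  shows "(CLINT x|lborel. complex_of_real (normal_density 0 \<sigma> x) * iexp (t * x)) = of_real (exp (- (\<sigma> * t)\<^sup>2 / 2))"
proof -
  have nd: "\<sigma> * normal_density 0 \<sigma> (\<sigma> * x) = std_normal_density x" for x
    using \<sigma> by (simp add: normal_density_def real_sqrt_mult field_simps power_mult_distrib)
  have "(CLINT x|lborel. complex_of_real (normal_density 0 \<sigma> x) * iexp (t * x))
      = \<bar>\<sigma>\<bar> *\<^sub>R (CLINT x|lborel. complex_of_real (normal_density 0 \<sigma> (0 + \<sigma> * x)) * iexp (t * (0 + \<sigma> * x)))"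
    by (rule lborel_integral_real_affine) (use \<sigma> in simp)
  also have "\<dots> = (CLINT x|lborel. complex_of_real (\<sigma> * normal_density 0 \<sigma> (\<sigma> * x)) * iexp (t * (\<sigma> * x)))"
    using \<sigma> by (simp add: scaleR_conv_of_real mult.assoc)
  also have "\<dots> = (CLINT x|lborel. std_normal_density x *\<^sub>R iexp ((\<sigma> * t) * x))"
    by (simp only: nd) (simp add: scaleR_conv_of_real mult_ac)
  also have "\<dots> = char std_normal_distribution (\<sigma> * t)"
    unfolding char_def by (subst integral_density) auto
  finally show ?thesis by (simp add: char_std_normal_distribution)
qed

text \<open>The quadratic exponential turns the centered Gaussian density of variance 1/2 into the
  one of variance \<open>1 / (2 * (1 + l))\<close>, up to the mass \<open>1 / sqrt (1 + l)\<close>.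
  Tilt and frequency are treated together because the rank-one computation below produces both at
  once.\<close>

lemma real_gaussian_half_tilted:
  assumes l: "l \<ge> 0"
  shows "(CLINT x|real_gaussian_half. of_real (exp (- (l * x\<^sup>2))) * iexp (t * x))
    = of_real (1 / sqrt (1 + l) * exp (- t\<^sup>2 / (4 * (1 + l))))"
proof -
  define \<sigma> where "\<sigma> = sqrt (1 / (2 * (1 + l)))"
  have \<sigma>: "\<sigma> > 0" "\<sigma>\<^sup>2 = 1 / (2 * (1 + l))" using l by (simp_all add: \<sigma>_def)
  have nd: "normal_density 0 (sqrt (1 / 2)) x * exp (- (l * x\<^sup>2)) = 1 / sqrt (1 + l) * normal_density 0 \<sigma> x" for x
  proof -
    have "exp (- x\<^sup>2) * exp (- (l * x\<^sup>2)) = exp (- ((1 + l) * x\<^sup>2))"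
      by (simp add: exp_add[symmetric] algebra_simps)
    moreover have "2 * pi * \<sigma>\<^sup>2 = pi / (1 + l)"
      using l by (simp add: \<sigma> field_simps)
    then have "sqrt (2 * pi * \<sigma>\<^sup>2) = sqrt pi / sqrt (1 + l)"
      by (simp add: real_sqrt_divide)
    moreover have "- x\<^sup>2 / (2 * \<sigma>\<^sup>2) = - ((1 + l) * x\<^sup>2)"
      using l by (simp add: \<sigma> field_simps)
    ultimately show ?thesis
      using l by (simp add: normal_density_def)
  qed
  have "(CLINT x|real_gaussian_half. of_real (exp (- (l * x\<^sup>2))) * iexp (t * x))
    = (CLINT x|lborel. normal_density 0 (sqrt (1 / 2)) x *\<^sub>R (of_real (exp (- (l * x\<^sup>2))) * iexp (t * x)))"
    unfolding real_gaussian_half_def by (subst integral_density) auto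
  also have "\<dots> = (CLINT x|lborel. of_real (normal_density 0 (sqrt (1 / 2)) x * exp (- (l * x\<^sup>2))) * iexp (t * x))"
    by (simp add: scaleR_conv_of_real mult.assoc)
  also have "\<dots> = (CLINT x|lborel. of_real (1 / sqrt (1 + l)) * (of_real (normal_density 0 \<sigma> x) * iexp (t * x)))"
    unfolding nd by (simp add: mult.assoc)
  also have "\<dots> = of_real (1 / sqrt (1 + l)) * of_real (exp (- (\<sigma> * t)\<^sup>2 / 2))"
    by (subst integral_mult_right_zero) (simp only: char_normal_density[OF \<sigma>(1)])
  also have "- (\<sigma> * t)\<^sup>2 / 2 = - t\<^sup>2 / (4 * (1 + l))"
    by (simp add: power_mult_distrib \<sigma>)
  finally show ?thesis by simp
qed

lemma prob_space_real_gaussian_half: "prob_space real_gaussian_half"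
  unfolding real_gaussian_half_def by (rule prob_space_normal_density) simp

lemma sets_real_gaussian_half [measurable_cong, simp]: "sets real_gaussian_half = sets borel"
  by (simp add: real_gaussian_half_def)

lemma sets_std_complex_gaussian [measurable_cong, simp]: "sets std_complex_gaussian = sets borel"
  by (simp add: std_complex_gaussian_def)

lemma borel_measurable_Complex:
  "(\<lambda>(x, y). Complex x y) \<in> borel_measurable (borel \<Otimes>\<^sub>M borel)"
proof -
  have "(\<lambda>p. complex_of_real (fst p) + \<i> * complex_of_real (snd p)) \<in> borel_measurable (borel \<Otimes>\<^sub>M borel)"
    by measurable
  then show ?thesis by (simp add: case_prod_beta' Complex_eq)
qed

lemma prob_space_std_complex_gaussian: "prob_space std_complex_gaussian"
proof -
  interpret G: prob_space real_gaussian_half by (rule prob_space_real_gaussian_half)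
  interpret GG: pair_prob_space real_gaussian_half real_gaussian_half ..
  have "(\<lambda>(x, y). Complex x y) \<in> real_gaussian_half \<Otimes>\<^sub>M real_gaussian_half \<rightarrow>\<^sub>M borel"
    using borel_measurable_Complex by (simp cong: measurable_cong_sets)
  then show ?thesis
    unfolding std_complex_gaussian_def by (rule GG.prob_space_distr)
qed

text \<open>\<open>Re (cnj w * z)\<close> is the real inner product of the plane, so the integral
  splits into real and imaginary part; the two masses \<open>1 / sqrt (1 + l)\<close> combine to
  \<open>1 / (1 + l)\<close>.\<close>

lemma std_complex_gaussian_tilted:
  assumes l: "l \<ge> 0"
  shows "(CLINT z|std_complex_gaussian. of_real (exp (- (l * (cmod z)\<^sup>2))) * iexp (Re (cnj w * z)))
    = of_real (1 / (1 + l) * exp (- (cmod w)\<^sup>2 / (4 * (1 + l))))"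
proof -
  interpret G: prob_space real_gaussian_half by (rule prob_space_real_gaussian_half)
  interpret GG: pair_prob_space real_gaussian_half real_gaussian_half ..
  let ?f = "\<lambda>t x. complex_of_real (exp (- (l * x\<^sup>2))) * iexp (t * x)"
  have C: "(\<lambda>(x, y). Complex x y) \<in> real_gaussian_half \<Otimes>\<^sub>M real_gaussian_half \<rightarrow>\<^sub>M borel"
    using borel_measurable_Complex by (simp cong: measurable_cong_sets)
  have int: "integrable (real_gaussian_half \<Otimes>\<^sub>M real_gaussian_half) (\<lambda>(x, y). ?f (Re w) x * ?f (Im w) y)"
  proof (rule GG.integrable_const_bound[of _ 1])
    show "AE x in real_gaussian_half \<Otimes>\<^sub>M real_gaussian_half.
        norm (case x of (x, y) \<Rightarrow> ?f (Re w) x * ?f (Im w) y) \<le> 1"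
      using l by (intro AE_I2) (auto simp: norm_mult mult_le_one)
  qed measurable
  have "(CLINT z|std_complex_gaussian. of_real (exp (- (l * (cmod z)\<^sup>2))) * iexp (Re (cnj w * z)))
    = (CLINT p|real_gaussian_half \<Otimes>\<^sub>M real_gaussian_half.
         of_real (exp (- (l * (cmod (case p of (x, y) \<Rightarrow> Complex x y))\<^sup>2)))
         * iexp (Re (cnj w * (case p of (x, y) \<Rightarrow> Complex x y))))"
    unfolding std_complex_gaussian_def by (rule integral_distr[OF C]) simp
  also have "\<dots> = (CLINT p|real_gaussian_half \<Otimes>\<^sub>M real_gaussian_half. case p of (x, y) \<Rightarrow> ?f (Re w) x * ?f (Im w) y)"
    by (intro Bochner_Integration.integral_cong refl)
      (auto simp: cmod_power2 exp_add[symmetric] algebra_simps simp flip: exp_of_real)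
  also have "\<dots> = (CLINT x|real_gaussian_half. CLINT y|real_gaussian_half. ?f (Re w) x * ?f (Im w) y)"
    using GG.integral_fst'[OF int] by simp
  also have "\<dots> = (CLINT x|real_gaussian_half. ?f (Re w) x) * (CLINT y|real_gaussian_half. ?f (Im w) y)"
    by simp
  also have "\<dots> = of_real (1 / sqrt (1 + l) * exp (- (Re w)\<^sup>2 / (4 * (1 + l))))
      * of_real (1 / sqrt (1 + l) * exp (- (Im w)\<^sup>2 / (4 * (1 + l))))"
    by (rule arg_cong2[of _ _ _ _ "(*)"]; rule real_gaussian_half_tilted[OF l])
  also have "\<dots> = of_real ((1 / sqrt (1 + l) * exp (- (Re w)\<^sup>2 / (4 * (1 + l))))
      * (1 / sqrt (1 + l) * exp (- (Im w)\<^sup>2 / (4 * (1 + l)))))"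
    by (rule of_real_mult[symmetric])
  also have "(1 / sqrt (1 + l) * exp (- (Re w)\<^sup>2 / (4 * (1 + l))))
      * (1 / sqrt (1 + l) * exp (- (Im w)\<^sup>2 / (4 * (1 + l))))
      = 1 / (sqrt (1 + l) * sqrt (1 + l)) * exp (- (Re w)\<^sup>2 / (4 * (1 + l)) + - (Im w)\<^sup>2 / (4 * (1 + l)))"
    unfolding exp_add by simp
  also have "\<dots> = 1 / (1 + l) * exp (- (cmod w)\<^sup>2 / (4 * (1 + l)))"
    using l by (simp add: cmod_power2 add_divide_distrib diff_divide_distrib)
  finally show ?thesis .
qed

abbreviation gaussian_vec :: "'i set \<Rightarrow> ('i \<Rightarrow> complex) measure" where
  "gaussian_vec I \<equiv> Pi\<^sub>M I (\<lambda>_. std_complex_gaussian)"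

lemma prob_space_gaussian_vec: "prob_space (gaussian_vec I)"
  by (intro prob_space_PiM prob_space_std_complex_gaussian)

lemma measurable_gaussian_vec_component:
  "i \<in> I \<Longrightarrow> (\<lambda>g. g i) \<in> borel_measurable (gaussian_vec I)"
  using measurable_component_singleton[of i I "\<lambda>_. std_complex_gaussian"]
  by (simp cong: measurable_cong_sets)

lemma gaussian_vec_tilted:
  assumes I: "finite I" and l: "l \<ge> 0"
  shows "(CLINT z|gaussian_vec I. of_real (exp (- (l * (\<Sum>i\<in>I. (cmod (z i))\<^sup>2)))) * iexp (\<Sum>i\<in>I. Re (cnj (w i) * z i)))
    = of_real (1 / (1 + l) ^ card I * exp (- (\<Sum>i\<in>I. (cmod (w i))\<^sup>2) / (4 * (1 + l))))"
proof -
  interpret G: prob_space std_complex_gaussian by (rule prob_space_std_complex_gaussian)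
  interpret P: product_sigma_finite "\<lambda>_::'a. std_complex_gaussian" ..
  let ?f = "\<lambda>i z. complex_of_real (exp (- (l * (cmod z)\<^sup>2))) * iexp (Re (cnj (w i) * z))"
  have "(CLINT z|gaussian_vec I. of_real (exp (- (l * (\<Sum>i\<in>I. (cmod (z i))\<^sup>2)))) * iexp (\<Sum>i\<in>I. Re (cnj (w i) * z i)))
      = (CLINT z|gaussian_vec I. \<Prod>i\<in>I. ?f i (z i))"
    using I by (intro Bochner_Integration.integral_cong refl)
      (simp add: prod.distrib exp_sum[symmetric] sum_distrib_left sum_negf flip: exp_of_real del: times_complex.sel)
  also have "\<dots> = (\<Prod>i\<in>I. CLINT z|std_complex_gaussian. ?f i z)"
  proof (rule P.product_integral_prod[OF I])
    show "integrable std_complex_gaussian (?f i)" for i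
      by (rule G.integrable_const_bound[of _ 1]) (use l in \<open>auto simp: norm_mult\<close>)
  qed
  also have "\<dots> = of_real (\<Prod>i\<in>I. 1 / (1 + l) * exp (- (cmod (w i))\<^sup>2 / (4 * (1 + l))))"
    unfolding std_complex_gaussian_tilted[OF l] by (simp only: of_real_prod)
  also have "(\<Prod>i\<in>I. 1 / (1 + l) * exp (- (cmod (w i))\<^sup>2 / (4 * (1 + l))))
      = 1 / (1 + l) ^ card I * exp (- (\<Sum>i\<in>I. (cmod (w i))\<^sup>2) / (4 * (1 + l)))"
    using I by (simp add: prod.distrib exp_sum[symmetric] sum_divide_distrib sum_negf power_one_over
        del: times_divide_eq_left)
  finally show ?thesis .
qed

lemma gaussian_vec_char:
  assumes I: "finite I"
  shows "(CLINT z|gaussian_vec I. iexp (\<Sum>i\<in>I. Re (cnj (w i) * z i)))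
    = of_real (exp (- (\<Sum>i\<in>I. (cmod (w i))\<^sup>2) / 4))"
  using gaussian_vec_tilted[OF I, of 0 w] by simp

text \<open>Writing the Gaussian factor \<open>exp (- l |y|\<^sup>2)\<close> as a characteristic function of an auxiliary
  Gaussian vector turns a quadratic functional into a linear one; exchanging the two Gaussian
  integrations replaces the matrix by its adjoint.\<close>

lemma gaussian_laplace_adjoint:
  assumes I: "finite I" and J: "finite J" and l: "l \<ge> 0"
  shows "(LINT g|gaussian_vec I. exp (- (l * (\<Sum>j\<in>J. (cmod (\<Sum>i\<in>I. K j i * g i))\<^sup>2))))
    = (LINT z|gaussian_vec J. exp (- (l * (\<Sum>i\<in>I. (cmod (\<Sum>j\<in>J. cnj (K j i) * z j))\<^sup>2))))"
proof -
  interpret GI: prob_space "gaussian_vec I" by (rule prob_space_gaussian_vec)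
  interpret GJ: prob_space "gaussian_vec J" by (rule prob_space_gaussian_vec)
  interpret GIJ: pair_prob_space "gaussian_vec I" "gaussian_vec J" ..
  \<comment> \<open>The characteristic function at frequency w is exp (- |w|^2 / 4); the scale
    \<open>2 * sqrt l\<close> cancels the 4 and leaves \<open>l\<close>.\<close>
  define s where "s = 2 * sqrt l"
  have s: "s\<^sup>2 = 4 * l" using l by (simp add: s_def power_mult_distrib)
  define y where "y g j = (\<Sum>i\<in>I. K j i * g i)" for g j
  define x where "x z i = (\<Sum>j\<in>J. cnj (K j i) * z j)" for z i
  have gauss: "(CLINT z|gaussian_vec H. iexp (\<Sum>i\<in>H. Re (cnj (of_real s * w i) * z i)))
      = of_real (exp (- (l * (\<Sum>i\<in>H. (cmod (w i))\<^sup>2))))" if "finite H" for H :: "'h set" and w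
    unfolding gaussian_vec_char[OF that]
    by (simp add: norm_mult power_mult_distrib s sum_distrib_left[symmetric])
  have swap: "(\<Sum>j\<in>J. Re (cnj (of_real s * y g j) * z j)) = (\<Sum>i\<in>I. Re (cnj (of_real s * x z i) * g i))" for g z
  proof -
    have "(\<Sum>j\<in>J. cnj (of_real s * y g j) * z j) = (\<Sum>j\<in>J. \<Sum>i\<in>I. of_real s * cnj (K j i) * cnj (g i) * z j)"
      by (simp add: y_def sum_distrib_left sum_distrib_right mult_ac)
    also have "\<dots> = (\<Sum>i\<in>I. \<Sum>j\<in>J. of_real s * cnj (K j i) * cnj (g i) * z j)"
      by (rule sum.swap)
    also have "\<dots> = (\<Sum>i\<in>I. cnj (cnj (of_real s * x z i) * g i))"
      by (simp add: x_def sum_distrib_left sum_distrib_right mult_ac)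
    finally have "Re (\<Sum>j\<in>J. cnj (of_real s * y g j) * z j) = Re (\<Sum>i\<in>I. cnj (cnj (of_real s * x z i) * g i))"
      by (rule arg_cong)
    then show ?thesis by (simp only: Re_sum cnj.sel(1))
  qed
  let ?F = "\<lambda>g z. iexp (\<Sum>j\<in>J. Re (cnj (of_real s * y g j) * z j))"
  have "(\<lambda>p. y (fst p) j) \<in> borel_measurable (gaussian_vec I \<Otimes>\<^sub>M gaussian_vec J)" for j
    unfolding y_def
    by (intro borel_measurable_sum borel_measurable_times borel_measurable_const
        measurable_compose[OF measurable_fst measurable_gaussian_vec_component])
  then have "(\<lambda>p. \<Sum>j\<in>J. Re (cnj (of_real s * y (fst p) j) * snd p j))
      \<in> borel_measurable (gaussian_vec I \<Otimes>\<^sub>M gaussian_vec J)"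
    by (intro borel_measurable_sum borel_measurable_Re_cnj_mult borel_measurable_times borel_measurable_const
        measurable_compose[OF measurable_snd measurable_gaussian_vec_component])
  then have meas: "(\<lambda>p. ?F (fst p) (snd p)) \<in> borel_measurable (gaussian_vec I \<Otimes>\<^sub>M gaussian_vec J)"
    by (rule measurable_compose) simp
  have int: "integrable (gaussian_vec I \<Otimes>\<^sub>M gaussian_vec J) (\<lambda>(g, z). ?F g z)"
    unfolding case_prod_beta' by (rule GIJ.integrable_const_bound[of _ 1, OF _ meas]) simp
  have "complex_of_real (LINT g|gaussian_vec I. exp (- (l * (\<Sum>j\<in>J. (cmod (y g j))\<^sup>2))))
      = (CLINT g|gaussian_vec I. CLINT z|gaussian_vec J. ?F g z)"
    unfolding integral_complex_of_real[symmetric] by (simp only: gauss[OF J])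
  also have "\<dots> = (CLINT z|gaussian_vec J. CLINT g|gaussian_vec I. ?F g z)"
    by (rule GIJ.Fubini_integral[OF int, symmetric])
  also have "\<dots> = of_real (LINT z|gaussian_vec J. exp (- (l * (\<Sum>i\<in>I. (cmod (x z i))\<^sup>2))))"
    unfolding integral_complex_of_real[symmetric] swap by (simp only: gauss[OF I])
  finally show ?thesis by (simp only: of_real_eq_iff y_def x_def)
qed

text \<open>The value is the reciprocal of the determinant of the identity plus \<open>l\<close>
  times the quadratic form. Instead of diagonalising, only the rank-one square is linearised, by a
  single auxiliary complex Gaussian \<open>\<zeta>\<close>; the integral over \<open>z\<close> then
  factors over the coordinates and leaves a Gaussian tilt in \<open>\<zeta>\<close>.\<close>

lemma gaussian_laplace_rank_one:
  fixes u :: "nat \<Rightarrow> complex"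
  assumes l: "l \<ge> 0" and d: "d \<ge> 1" and \<theta>: "\<theta> > 1" and u: "(\<Sum>k<d. (cmod (u k))\<^sup>2) = 1"
  shows "(LINT z|gaussian_vec {..<d}. exp (- (l * ((\<Sum>k<d. (cmod (z k))\<^sup>2) + (\<theta> - 1) * (cmod (\<Sum>k<d. cnj (u k) * z k))\<^sup>2))))
    = 1 / ((1 + l) ^ (d - 1) * (1 + l * \<theta>))"
proof -
  interpret GJ: prob_space "gaussian_vec {..<d}" by (rule prob_space_gaussian_vec)
  interpret G: prob_space std_complex_gaussian by (rule prob_space_std_complex_gaussian)
  interpret GIJ: pair_prob_space "gaussian_vec {..<d}" std_complex_gaussian ..
  define s where "s = 2 * sqrt (l * (\<theta> - 1))"
  have s: "s\<^sup>2 = 4 * (l * (\<theta> - 1))" using l \<theta> by (simp add: s_def power_mult_distrib)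
  define y where "y z = (\<Sum>k<d. cnj (u k) * z k)" for z
  define r where "r z = (\<Sum>k<d. (cmod (z k))\<^sup>2)" for z :: "nat \<Rightarrow> complex"
  have r: "r z \<ge> 0" for z by (simp add: r_def sum_nonneg)
  have rm: "r \<in> borel_measurable (gaussian_vec {..<d})" unfolding r_def
    by (intro borel_measurable_sum borel_measurable_power measurable_compose[OF measurable_gaussian_vec_component borel_measurable_norm])
  have ym: "y \<in> borel_measurable (gaussian_vec {..<d})" unfolding y_def
    by (intro borel_measurable_sum borel_measurable_times borel_measurable_const measurable_gaussian_vec_component)
  have one: "(CLINT \<zeta>|std_complex_gaussian. iexp (Re (cnj (of_real s * w) * \<zeta>)))
      = of_real (exp (- (l * ((\<theta> - 1) * (cmod w)\<^sup>2))))" for w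
    using std_complex_gaussian_tilted[of 0 "of_real s * w"]
    by (simp add: norm_mult power_mult_distrib s mult.assoc)
  have swap: "Re (cnj (of_real s * y z) * \<zeta>) = (\<Sum>k<d. Re (cnj (of_real s * \<zeta> * u k) * z k))" for z \<zeta>
  proof -
    have "cnj (of_real s * y z) * \<zeta> = (\<Sum>k<d. cnj (cnj (of_real s * \<zeta> * u k) * z k))"
      by (simp add: y_def sum_distrib_left sum_distrib_right mult_ac)
    then show ?thesis by (simp only: Re_sum cnj.sel(1))
  qed
  have q: "1 + l > 0" using l by simp
  let ?F = "\<lambda>z \<zeta>. of_real (exp (- (l * r z))) * iexp (Re (cnj (of_real s * y z) * \<zeta>))"
  have int: "integrable (gaussian_vec {..<d} \<Otimes>\<^sub>M std_complex_gaussian) (\<lambda>(z, \<zeta>). ?F z \<zeta>)"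
  proof (rule GIJ.integrable_const_bound[of _ 1])
    show "AE p in gaussian_vec {..<d} \<Otimes>\<^sub>M std_complex_gaussian. norm (case p of (z, \<zeta>) \<Rightarrow> ?F z \<zeta>) \<le> 1"
      using l r by (intro AE_I2) (simp add: norm_mult case_prod_beta')
    have "(\<lambda>p. complex_of_real (exp (- (l * r (fst p))))) \<in> borel_measurable (gaussian_vec {..<d} \<Otimes>\<^sub>M std_complex_gaussian)"
      by (rule measurable_compose[OF measurable_compose[OF measurable_fst rm]]) simp
    moreover have "(\<lambda>p. Re (cnj (of_real s * y (fst p)) * snd p))
        \<in> borel_measurable (gaussian_vec {..<d} \<Otimes>\<^sub>M std_complex_gaussian)"
      by (intro borel_measurable_Re_cnj_mult borel_measurable_times borel_measurable_const
          measurable_compose[OF measurable_fst ym]) simp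
    then have "(\<lambda>p. iexp (Re (cnj (of_real s * y (fst p)) * snd p)))
        \<in> borel_measurable (gaussian_vec {..<d} \<Otimes>\<^sub>M std_complex_gaussian)"
      by (rule measurable_compose) simp
    ultimately show "(\<lambda>(z, \<zeta>). ?F z \<zeta>) \<in> borel_measurable (gaussian_vec {..<d} \<Otimes>\<^sub>M std_complex_gaussian)"
      unfolding case_prod_beta' by (rule borel_measurable_times)
  qed
  have "complex_of_real (LINT z|gaussian_vec {..<d}. exp (- (l * (r z + (\<theta> - 1) * (cmod (y z))\<^sup>2))))
      = (CLINT z|gaussian_vec {..<d}. of_real (exp (- (l * r z))) * of_real (exp (- (l * ((\<theta> - 1) * (cmod (y z))\<^sup>2)))))"
    unfolding integral_complex_of_real[symmetric]
    by (simp add: exp_add[symmetric] algebra_simps flip: exp_of_real)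
  also have "\<dots> = (CLINT z|gaussian_vec {..<d}. CLINT \<zeta>|std_complex_gaussian. ?F z \<zeta>)"
    unfolding one[symmetric] by simp
  also have "\<dots> = (CLINT \<zeta>|std_complex_gaussian. CLINT z|gaussian_vec {..<d}. ?F z \<zeta>)"
    by (rule GIJ.Fubini_integral[OF int, symmetric])
  also have "\<dots> = (CLINT \<zeta>|std_complex_gaussian. of_real (1 / (1 + l) ^ d *
      exp (- (\<Sum>k<d. (cmod (of_real s * \<zeta> * u k))\<^sup>2) / (4 * (1 + l)))))"
    unfolding swap r_def
    by (subst gaussian_vec_tilted[OF _ l]) simp_all
  \<comment> \<open>Since \<open>u\<close> is a unit vector, the sum over \<open>k\<close>
    collapses, and what remains is a tilt of \<open>\<zeta>\<close> with parameter
    \<open>l * (\<theta> - 1) / (1 + l)\<close>.\<close>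
  also have "\<dots> = (CLINT \<zeta>|std_complex_gaussian. of_real (1 / (1 + l) ^ d) *
      of_real (exp (- (l * (\<theta> - 1) / (1 + l) * (cmod \<zeta>)\<^sup>2))))"
  proof -
    have "(\<Sum>k<d. (cmod (of_real s * \<zeta> * u k))\<^sup>2) = 4 * (l * (\<theta> - 1)) * (cmod \<zeta>)\<^sup>2" for \<zeta>
      using u by (simp add: norm_mult power_mult_distrib s sum_distrib_left[symmetric])
    moreover have "- (4 * (l * (\<theta> - 1)) * c) / (4 * (1 + l)) = - (l * (\<theta> - 1) / (1 + l) * c)" for c
      using q by (simp add: field_simps)
    ultimately have "- (\<Sum>k<d. (cmod (of_real s * \<zeta> * u k))\<^sup>2) / (4 * (1 + l)) = - (l * (\<theta> - 1) / (1 + l) * (cmod \<zeta>)\<^sup>2)" for \<zeta>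
      by (simp only:)
    then show ?thesis by (simp only: of_real_mult)
  qed
  also have "\<dots> = of_real (1 / (1 + l) ^ d) * of_real (1 / (1 + l * (\<theta> - 1) / (1 + l)))"
    using std_complex_gaussian_tilted[of "l * (\<theta> - 1) / (1 + l)" 0] l \<theta>
    by (subst integral_mult_right_zero) simp
  also have "\<dots> = of_real (1 / (1 + l) ^ d * (1 / (1 + l * (\<theta> - 1) / (1 + l))))"
    by simp
  also have "1 / (1 + l) ^ d * (1 / (1 + l * (\<theta> - 1) / (1 + l))) = 1 / ((1 + l) ^ (d - 1) * (1 + l * \<theta>))"
  proof -
    have "1 + l * (\<theta> - 1) / (1 + l) = (1 + l * \<theta>) / (1 + l)" using q by (simp add: field_simps)
    moreover have "(1 + l) ^ d = (1 + l) ^ (d - 1) * (1 + l)" using d by (cases d) auto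
    ultimately show ?thesis using q by simp
  qed
  finally show ?thesis by (simp only: of_real_eq_iff r_def y_def)
qed

subsection \<open>Uniqueness of the Laplace transform\<close>

text \<open>Polynomials in \<open>exp (- x)\<close> are uniformly dense among the functions of \<open>exp (- x)\<close> that are
  continuous on \<open>[0, 1]\<close>; damping the trigonometric functions by \<open>exp (- \<epsilon> x)\<close> brings them into
  that class, so that the Laplace transform determines the characteristic function.\<close>

lemma laplace_uniqueness:
  assumes M1: "real_distribution M1" and M2: "real_distribution M2"
    and pos1: "AE x in M1. 0 \<le> x" and pos2: "AE x in M2. 0 \<le> x"
    and eq: "\<And>n::nat. n \<ge> 1 \<Longrightarrow> (LINT x|M1. exp (- (real n * x))) = (LINT x|M2. exp (- (real n * x)))"
  shows "M1 = M2"
proof -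
  interpret M1: real_distribution M1 by (rule M1)
  interpret M2: real_distribution M2 by (rule M2)
  have eq': "(LINT x|M1. exp (- x) ^ n) = (LINT x|M2. exp (- x) ^ n)" for n
    using eq[of n] M1.prob_space M2.prob_space
    by (cases "n = 0") (simp_all add: exp_of_nat_mult[symmetric])
  \<comment> \<open>Under u = exp (- x) the given values are the moments of a law on [0, 1], which
    is why integer arguments of the transform suffice.\<close>
  have cont: "(LINT x|M1. h (exp (- x))) = (LINT x|M2. h (exp (- x)))"
    if h: "continuous_on {0..1} h" and [measurable]: "h \<in> borel_measurable borel" for h :: "real \<Rightarrow> real"
  proof -
    have *: "\<bar>(LINT x|M1. h (exp (- x))) - (LINT x|M2. h (exp (- x)))\<bar> \<le> 2 * e" if "e > 0" for e :: real
    proof -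
      obtain g where g: "real_polynomial_function g" "\<And>x. x \<in> {0..1} \<Longrightarrow> \<bar>h x - g x\<bar> < e"
        using Stone_Weierstrass_real_polynomial_function[of "{0..1::real}" h e] h \<open>e > 0\<close> by auto
      then obtain a n where ga: "g = (\<lambda>x. \<Sum>i\<le>n. a i * x ^ i)"
        using real_polynomial_function_iff_sum by blast
      obtain B where B: "\<And>x. x \<in> {0..1} \<Longrightarrow> \<bar>h x\<bar> \<le> B"
      proof -
        have "bounded (h ` {0..1})"
          using h by (intro compact_imp_bounded compact_continuous_image) auto
        then obtain B where "\<forall>x\<in>h ` {0..1}. norm x \<le> B" unfolding bounded_iff by blast
        then show ?thesis by (intro that[of B]) auto
      qed
      have approx: "\<bar>(LINT x|M. h (exp (- x))) - (\<Sum>i\<le>n. a i * (LINT x|M. exp (- x) ^ i))\<bar> \<le> e"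
        if "real_distribution M" and pos: "AE x in M. 0 \<le> x" for M
      proof -
        interpret real_distribution M by fact
        have ih: "integrable M (\<lambda>x. h (exp (- x)))"
          by (rule integrable_const_bound[of _ B]) (use pos B in \<open>auto elim!: eventually_mono\<close>)
        have ip: "integrable M (\<lambda>x. exp (- x) ^ i)" for i
          by (rule integrable_const_bound[of _ 1])
            (use pos in \<open>auto elim!: eventually_mono simp: power_le_one\<close>)
        have ig: "integrable M (\<lambda>x. g (exp (- x)))"
          unfolding ga by (intro Bochner_Integration.integrable_sum integrable_mult_right ip)
        have "(\<Sum>i\<le>n. a i * (LINT x|M. exp (- x) ^ i)) = (LINT x|M. g (exp (- x)))"
          unfolding ga by (subst Bochner_Integration.integral_sum) (auto intro!: integrable_mult_right ip)
        then have "\<bar>(LINT x|M. h (exp (- x))) - (\<Sum>i\<le>n. a i * (LINT x|M. exp (- x) ^ i))\<bar>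
            = \<bar>LINT x|M. h (exp (- x)) - g (exp (- x))\<bar>"
          using ih ig by simp
        also have "\<dots> \<le> (LINT x|M. \<bar>h (exp (- x)) - g (exp (- x))\<bar>)"
          by (rule integral_abs_bound)
        also have "\<dots> \<le> (LINT x|M. e)"
          by (rule integral_mono_AE)
            (use pos ih ig in \<open>auto elim!: eventually_mono intro!: less_imp_le g\<close>)
        finally show ?thesis using prob_space by simp
      qed
      show ?thesis using approx[OF M1 pos1] approx[OF M2 pos2] by (simp add: eq')
    qed
    have "\<bar>(LINT x|M1. h (exp (- x))) - (LINT x|M2. h (exp (- x)))\<bar> \<le> 0"
    proof (rule field_le_epsilon)
      fix e :: real assume "e > 0"
      then show "\<bar>(LINT x|M1. h (exp (- x))) - (LINT x|M2. h (exp (- x)))\<bar> \<le> 0 + e"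
        using *[of "e / 2"] by simp
    qed
    then show ?thesis by simp
  qed
  have damped: "(LINT x|M1. exp (- (\<epsilon> * x)) * g x) = (LINT x|M2. exp (- (\<epsilon> * x)) * g x)"
    if \<epsilon>: "\<epsilon> > 0" and g: "continuous_on UNIV g" and g1: "\<And>x. \<bar>g x\<bar> \<le> 1" for \<epsilon> :: real and g :: "real \<Rightarrow> real"
  proof -
    have [measurable]: "g \<in> borel_measurable borel" using g by (rule borel_measurable_continuous_onI)
    \<comment> \<open>\<open>g (- ln u)\<close> may oscillate as \<open>u\<close> tends to 0. The
      factor \<open>u powr \<epsilon>\<close> forces the limit 0, which is the value of
      \<open>h\<close> at 0 because \<open>0 powr \<epsilon> = 0\<close>.\<close>
    define h where "h u = u powr \<epsilon> * g (- ln u)" for u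
    have "continuous_on {0..1} h"
      unfolding continuous_on_eq_continuous_within
    proof
      fix u :: real assume u: "u \<in> {0..1}"
      show "continuous (at u within {0..1}) h"
      proof (cases "u = 0")
        case False
        have "isCont g x" for x using g by (simp add: continuous_on_eq_continuous_at)
        then have "isCont (\<lambda>u. g (- ln u)) u"
          using False by (intro isCont_o2[where f = "\<lambda>u. - ln u" and g = g] continuous_intros) auto
        then have "isCont h u"
          unfolding h_def using False by (intro continuous_intros) auto
        then show ?thesis by (rule continuous_at_imp_continuous_at_within)
      next
        case True
        have "((\<lambda>u. u powr \<epsilon>) \<longlongrightarrow> 0 powr \<epsilon>) (at 0 within {0..1})"
          using \<epsilon> by (intro tendsto_powr' tendsto_intros) (auto simp: eventually_at_filter)
        then have "((\<lambda>u. u powr \<epsilon>) \<longlongrightarrow> 0) (at 0 within {0..1})" by simp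
        then have "(h \<longlongrightarrow> 0) (at 0 within {0..1})"
          by (rule Lim_null_comparison[rotated])
            (auto simp: h_def abs_mult intro!: always_eventually mult_left_le g1)
        then show ?thesis by (simp add: True continuous_within h_def)
      qed
    qed
    moreover have "h \<in> borel_measurable borel" unfolding h_def by measurable
    ultimately have "(LINT x|M1. h (exp (- x))) = (LINT x|M2. h (exp (- x)))" by (rule cont)
    then show ?thesis by (simp add: h_def powr_def)
  qed
  have bounded: "(LINT x|M1. g x) = (LINT x|M2. g x)"
    if g: "continuous_on UNIV g" and g1: "\<And>x. \<bar>g x\<bar> \<le> 1" for g :: "real \<Rightarrow> real"
  proof -
    have [measurable]: "g \<in> borel_measurable borel" using g by (rule borel_measurable_continuous_onI)
    have lim: "(\<lambda>n. LINT x|M. exp (- (inverse (real (Suc n)) * x)) * g x) \<longlonglongrightarrow> (LINT x|M. g x)"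
      if "real_distribution M" and pos: "AE x in M. 0 \<le> x" for M
    proof -
      interpret real_distribution M by fact
      show ?thesis
      proof (rule integral_dominated_convergence[where w = "\<lambda>_. 1"])
        have "(\<lambda>n. exp (- (inverse (real (Suc n)) * x)) * g x) \<longlonglongrightarrow> exp (- (0 * x)) * g x" for x
          by (intro tendsto_intros LIMSEQ_inverse_real_of_nat)
        then show "AE x in M. (\<lambda>n. exp (- (inverse (real (Suc n)) * x)) * g x) \<longlonglongrightarrow> g x" by simp
        show "AE x in M. norm (exp (- (inverse (real (Suc n)) * x)) * g x) \<le> 1" for n
          using pos by eventually_elim (auto simp: abs_mult intro!: mult_le_one g1)
      qed auto
    qed
    have e: "(LINT x|M1. exp (- (inverse (real (Suc n)) * x)) * g x)
        = (LINT x|M2. exp (- (inverse (real (Suc n)) * x)) * g x)" for n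
      by (rule damped[OF _ g g1]) simp
    show ?thesis
      by (rule LIMSEQ_unique[OF lim[OF M1 pos1] lim[OF M2 pos2, folded e]])
  qed
  have char: "char M t = Complex (LINT x|M. cos (t * x)) (LINT x|M. sin (t * x))"
    if "real_distribution M" for M t
  proof -
    interpret real_distribution M by fact
    have i: "integrable M (\<lambda>x. iexp (t * x))" by (rule integrable_iexp) auto
    show ?thesis
      unfolding char_def
      by (rule complex_eqI) (use integral_Re[OF i] integral_Im[OF i] in \<open>simp_all add: Re_exp Im_exp\<close>)
  qed
  have "char M1 = char M2"
    by (rule ext) (simp add: char[OF M1] char[OF M2] bounded continuous_intros)
  then show ?thesis by (rule Levy_uniqueness[OF M1 M2])
qed

subsection \<open>Logarithmic moments\<close>

text \<open>Convexity of \<open>exp\<close> between 0 and \<open>ln x\<close>. The right-hand side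
  is the tangent of \<open>x powr t\<close> at 1, so fractional moments are controlled by the
  mean.\<close>

lemma powr_le_affine:
  fixes x t :: real
  assumes "x > 0" "0 \<le> t" "t \<le> 1"
  shows "x powr t \<le> 1 + t * (x - 1)"
proof -
  have "exp ((1 - t) *\<^sub>R 0 + t *\<^sub>R ln x) \<le> (1 - t) * exp 0 + t * exp (ln x)"
    by (rule convex_onD[OF exp_convex]) (use assms in auto)
  then show ?thesis using assms by (simp add: powr_def algebra_simps)
qed

lemma powr_ge_affine_ln:
  fixes x t :: real
  assumes "x > 0"
  shows "1 + t * ln x \<le> x powr t"
  using assms exp_ge_add_one_self[of "t * ln x"] by (simp add: powr_def)

context prob_space
begin

lemma integrable_powr_le_one:
  fixes X :: "'a \<Rightarrow> real"
  assumes pos: "AE x in M. X x > 0" and X: "integrable M X" and t: "0 \<le> t" "t \<le> 1"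
  shows "integrable M (\<lambda>x. X x powr t)"
proof (rule Bochner_Integration.integrable_bound)
  show "integrable M (\<lambda>x. 1 + t * (X x - 1))" using X by simp
  have [measurable]: "X \<in> borel_measurable M" using X by simp
  show "(\<lambda>x. X x powr t) \<in> borel_measurable M" by measurable
  show "AE x in M. norm (X x powr t) \<le> norm (1 + t * (X x - 1))"
    using pos
  proof eventually_elim
    case (elim x)
    from powr_le_affine[OF this t] show ?case using powr_ge_zero[of "X x" t] unfolding real_norm_def by linarith
  qed
qed

text \<open>The right derivative at 0 of the moment of order t is the mean of \<open>ln X\<close>.
  The difference quotients lie between \<open>ln X\<close> and \<open>X - 1\<close>, which are both
  integrable, so dominated convergence applies along t = 1 / (n + 1).\<close>

lemma expectation_powr_derivative:
  fixes X :: "'a \<Rightarrow> real"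
  assumes pos: "AE x in M. X x > 0" and X: "integrable M X" and lnX: "integrable M (\<lambda>x. ln (X x))"
  shows "(\<lambda>n. (expectation (\<lambda>x. X x powr inverse (real (Suc n))) - 1) * real (Suc n))
    \<longlonglongrightarrow> expectation (\<lambda>x. ln (X x))"
proof -
  have [measurable]: "X \<in> borel_measurable M" using X by simp
  let ?s = "\<lambda>n x. (X x powr inverse (real (Suc n)) - 1) * real (Suc n)"
  have "(\<lambda>n. expectation (?s n)) \<longlonglongrightarrow> expectation (\<lambda>x. ln (X x))"
  proof (rule integral_dominated_convergence[where w = "\<lambda>x. \<bar>ln (X x)\<bar> + \<bar>X x - 1\<bar>"])
    show "integrable M (\<lambda>x. \<bar>ln (X x)\<bar> + \<bar>X x - 1\<bar>)" using X lnX by simp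
    show "AE x in M. (\<lambda>n. ?s n x) \<longlonglongrightarrow> ln (X x)"
      using pos
    proof eventually_elim
      case (elim x)
      have "((\<lambda>t. exp (t * ln (X x))) has_real_derivative ln (X x)) (at 0)"
        by (auto intro!: derivative_eq_intros)
      then have "((\<lambda>h. (exp (h * ln (X x)) - 1) / h) \<longlongrightarrow> ln (X x)) (at 0)"
        unfolding DERIV_def by simp
      moreover have "filterlim (\<lambda>n. inverse (real (Suc n))) (at 0) sequentially"
        by (intro filterlim_atI LIMSEQ_inverse_real_of_nat) auto
      ultimately have "(\<lambda>n. (exp (inverse (real (Suc n)) * ln (X x)) - 1) / inverse (real (Suc n))) \<longlonglongrightarrow> ln (X x)"
        by (rule filterlim_compose)
      then show ?case using elim by (simp add: powr_def field_simps)
    qed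
    show "AE x in M. norm (?s n x) \<le> \<bar>ln (X x)\<bar> + \<bar>X x - 1\<bar>" for n
      using pos
    proof eventually_elim
      case (elim x)
      have "X x powr inverse (real (Suc n)) - 1 \<le> inverse (real (Suc n)) * (X x - 1)"
        using powr_le_affine[OF elim, of "inverse (real (Suc n))"] by (simp add: field_simps)
      then have "?s n x \<le> inverse (real (Suc n)) * (X x - 1) * real (Suc n)"
        by (rule mult_right_mono) simp
      moreover have "inverse (real (Suc n)) * ln (X x) \<le> X x powr inverse (real (Suc n)) - 1"
        using powr_ge_affine_ln[OF elim, of "inverse (real (Suc n))"] by simp
      then have "inverse (real (Suc n)) * ln (X x) * real (Suc n) \<le> ?s n x"
        by (rule mult_right_mono) simp
      moreover have "inverse (real (Suc n)) * y * real (Suc n) = y" for y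
        by (simp del: of_nat_Suc)
      ultimately have "?s n x \<le> X x - 1" "ln (X x) \<le> ?s n x" by (simp_all only:)
      then show ?case unfolding real_norm_def abs_le_iff by linarith
    qed
  qed measurable
  moreover have "expectation (?s n) = (expectation (\<lambda>x. X x powr inverse (real (Suc n))) - 1) * real (Suc n)" for n
    using integrable_powr_le_one[OF pos X, of "inverse (real (Suc n))"]
    by (simp add: prob_space field_simps del: of_nat_Suc)
  ultimately show ?thesis by simp
qed

text \<open>For small t the moment is 1 + t E(ln X) + o(t), hence below \<open>1 + t * K\<close>.
  This selects the exponent in the Chernoff bounds.\<close>

lemma expectation_powr_less_exp:
  fixes X :: "'a \<Rightarrow> real"
  assumes pos: "AE x in M. X x > 0" and X: "integrable M X" and lnX: "integrable M (\<lambda>x. ln (X x))"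
    and K: "expectation (\<lambda>x. ln (X x)) < K"
  obtains t where "0 < t" "t \<le> 1" "expectation (\<lambda>x. X x powr t) < exp (t * K)"
proof -
  from order_tendstoD(2)[OF expectation_powr_derivative[OF pos X lnX] K]
  obtain n where n: "(expectation (\<lambda>x. X x powr inverse (real (Suc n))) - 1) * real (Suc n) < K"
    by (auto simp: eventually_sequentially)
  define t where "t = inverse (real (Suc n))"
  have t: "0 < t" "t \<le> 1" "t * real (Suc n) = 1" by (auto simp: t_def field_simps)
  have "(expectation (\<lambda>x. X x powr t) - 1) * real (Suc n) * t < K * t"
    using n t by (intro mult_strict_right_mono) (auto simp: t_def)
  also have "(expectation (\<lambda>x. X x powr t) - 1) * real (Suc n) * t = expectation (\<lambda>x. X x powr t) - 1"
    using t(3) by (simp add: mult.assoc mult.commute[of _ t] del: of_nat_Suc)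
  finally have "expectation (\<lambda>x. X x powr t) < 1 + t * K"
    by (simp add: mult.commute)
  also have "\<dots> \<le> exp (t * K)" by (rule exp_ge_add_one_self)
  finally show ?thesis using t that by blast
qed

end

text \<open>Combines \<open>1 + q * ln (1 + z) \<le> (1 + z) powr q\<close> with the subadditivity
  bound \<open>(1 + z) powr q \<le> 1 + z powr q\<close>.\<close>

lemma ln_one_plus_le_powr:
  fixes z q :: real
  assumes z: "z \<ge> 0" and q: "0 < q" "q \<le> 1"
  shows "ln (1 + z) \<le> z powr q / q"
proof (cases "z = 0")
  case False
  then have z: "z > 0" using assms by simp
  have "(1 + z) powr q = (1 + z) powr (q - 1) + z * (1 + z) powr (q - 1)"
    using z powr_add[of "1 + z" 1 "q - 1"] by (simp add: algebra_simps)
  moreover have "(1 + z) powr (q - 1) \<le> 1"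
    using powr_mono[of "q - 1" 0 "1 + z"] z q by simp
  moreover have "z * (1 + z) powr (q - 1) \<le> z * z powr (q - 1)"
    using z q by (intro mult_left_mono powr_mono2') auto
  moreover have "z * z powr (q - 1) = z powr q"
    using z by (simp add: powr_diff)
  ultimately have "(1 + z) powr q \<le> 1 + z powr q" by linarith
  moreover have "1 + q * ln (1 + z) \<le> (1 + z) powr q"
    using z by (intro powr_ge_affine_ln) simp
  ultimately have "q * ln (1 + z) \<le> z powr q" by linarith
  then show ?thesis using q by (simp add: field_simps)
qed (use assms in simp)

section \<open>The standard exponential law and the mean of its logarithm\<close>

abbreviation std_exponential :: "real measure" where
  "std_exponential \<equiv> density lborel (exponential_density 1)"

lemma real_distribution_erlang: "real_distribution (density lborel (erlang_density k 1))"
  by (intro real_distribution.intro real_distribution_axioms.intro prob_space_erlang_density) auto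

lemma std_exponential_powr:
  assumes "s > 0"
  shows "has_bochner_integral std_exponential (\<lambda>x. x powr (s - 1)) (Gamma s)"
proof (rule has_bochner_integral_nn_integral)
  have "(\<integral>\<^sup>+x. ennreal (x powr (s - 1)) \<partial>std_exponential)
      = (\<integral>\<^sup>+x. ennreal (exponential_density 1 x) * ennreal (x powr (s - 1)) \<partial>lborel)"
    by (rule nn_integral_density) auto
  also have "\<dots> = (\<integral>\<^sup>+x. ennreal (indicator {0..} x * x powr (s - 1) / exp x) \<partial>lborel)"
    by (intro nn_integral_cong)
      (auto simp: exponential_density_def exp_minus field_simps indicator_def simp flip: ennreal_mult)
  also have "\<dots> = Gamma s" using Gamma_conv_nn_integral_real[OF assms] by simp
  finally show "(\<integral>\<^sup>+x. ennreal (x powr (s - 1)) \<partial>std_exponential) = ennreal (Gamma s)" .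
qed (use assms in \<open>auto intro: Gamma_real_nonneg\<close>)

lemma AE_std_exponential_pos: "AE x in std_exponential. x > 0"
  using AE_lborel_singleton[of "0::real"]
  by (subst AE_density) (auto simp: exponential_density_def elim!: eventually_mono)

lemma integrable_std_exponential: "integrable std_exponential (\<lambda>x. x)"
proof -
  have "integrable std_exponential (\<lambda>x. x powr (2 - 1))"
    using std_exponential_powr[of 2] by (rule integrable.intros[OF _]) simp
  then show ?thesis
    by (rule integrable_cong_AE_imp) (use AE_std_exponential_pos in \<open>auto elim!: eventually_mono\<close>)
qed

lemma integrable_ln_std_exponential: "integrable std_exponential ln"
proof (rule Bochner_Integration.integrable_bound)
  \<comment> \<open>The first term dominates the logarithm at infinity, the second one near
    0.\<close>
  show "integrable std_exponential (\<lambda>x. x + 2 * x powr (1 / 2 - 1))"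
    using integrable_std_exponential std_exponential_powr[of "1 / 2"]
    by (intro Bochner_Integration.integrable_add integrable_mult_right) (auto intro: integrable.intros)
  show "AE x in std_exponential. norm (ln x) \<le> norm (x + 2 * x powr (1 / 2 - 1))"
    using AE_std_exponential_pos
  proof eventually_elim
    case (elim x)
    have "ln x \<le> x" using elim ln_bound by simp
    moreover have "- (1 / 2) * ln x \<le> x powr (1 / 2 - 1)"
      using powr_ge_affine_ln[OF elim, of "- (1 / 2)"] by simp
    moreover have "x powr (1 / 2 - 1) \<ge> 0" by simp
    ultimately show ?case using elim unfolding real_norm_def by linarith
  qed
qed measurable

text \<open>The moment of order t is \<open>Gamma (1 + t)\<close>, so the mean of the logarithm is
  the derivative of \<open>Gamma\<close> at 1, that is \<open>Digamma 1\<close>. Both are limits of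
  the same difference quotients.\<close>

lemma expectation_ln_std_exponential: "(LINT x|std_exponential. ln x) = - euler_mascheroni"
proof -
  interpret prob_space std_exponential by (rule prob_space_exponential_density) simp
  have "(\<lambda>n. (expectation (\<lambda>x. x powr inverse (real (Suc n))) - 1) * real (Suc n)) \<longlonglongrightarrow> expectation ln"
    by (rule expectation_powr_derivative[OF AE_std_exponential_pos integrable_std_exponential integrable_ln_std_exponential])
  moreover have "expectation (\<lambda>x. x powr inverse (real (Suc n))) = Gamma (1 + inverse (real (Suc n)))" for n
    using has_bochner_integral_integral_eq[OF std_exponential_powr[of "1 + inverse (real (Suc n))"]]
    by (simp add: add_pos_pos)
  ultimately have 1: "(\<lambda>n. (Gamma (1 + inverse (real (Suc n))) - 1) * real (Suc n)) \<longlonglongrightarrow> expectation ln"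
    by simp
  have "(Gamma has_real_derivative Gamma 1 * Digamma 1) (at 1)"
    by (rule has_field_derivative_Gamma) (auto simp: nonpos_Ints_def)
  then have "((\<lambda>h. (Gamma (1 + h) - 1) / h) \<longlongrightarrow> - euler_mascheroni) (at (0::real))"
    by (simp add: DERIV_def)
  moreover have "filterlim (\<lambda>n. inverse (real (Suc n))) (at 0) sequentially"
    by (intro filterlim_atI LIMSEQ_inverse_real_of_nat) auto
  ultimately have "(\<lambda>n. (Gamma (1 + inverse (real (Suc n))) - 1) / inverse (real (Suc n))) \<longlonglongrightarrow> - euler_mascheroni"
    by (rule filterlim_compose)
  then have "(\<lambda>n. (Gamma (1 + inverse (real (Suc n))) - 1) * real (Suc n)) \<longlonglongrightarrow> - euler_mascheroni"
    by (simp add: divide_inverse del: of_nat_Suc)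
  from LIMSEQ_unique[OF 1 this] show ?thesis .
qed

section \<open>Gamma laws and the law of \<open>\<theta> x + s\<close>\<close>

lemma erlang_laplace:
  assumes l: "l \<ge> 0"
  shows "(LINT x|density lborel (erlang_density k 1). exp (- (l * x))) = 1 / (1 + l) ^ Suc k"
proof -
  have "has_bochner_integral lborel (erlang_density k (1 + l)) 1"
    using nn_integral_erlang_ith_moment[of "1 + l" k 0] l by (intro has_bochner_integral_nn_integral) auto
  then have 1: "(LINT x|lborel. erlang_density k (1 + l) x) = 1" by (rule has_bochner_integral_integral_eq)
  have "(LINT x|density lborel (erlang_density k 1). exp (- (l * x)))
      = (LINT x|lborel. erlang_density k 1 x *\<^sub>R exp (- (l * x)))"
    by (rule integral_density) auto
  \<comment> \<open>The exponential tilt changes the rate of the density from 1 to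
    \<open>1 + l\<close>; the power is the ratio of the normalising constants.\<close>
  also have "\<dots> = (LINT x|lborel. 1 / (1 + l) ^ Suc k * erlang_density k (1 + l) x)"
  proof (intro Bochner_Integration.integral_cong refl)
    fix x :: real
    have *: "exp (- (1 + l) * x) = exp (- 1 * x) * exp (- (l * x))"
      by (simp add: exp_add[symmetric] algebra_simps)
    show "erlang_density k 1 x *\<^sub>R exp (- (l * x)) = 1 / (1 + l) ^ Suc k * erlang_density k (1 + l) x"
      using l unfolding erlang_density_def * by simp
  qed
  also have "\<dots> = 1 / (1 + l) ^ Suc k" by (subst integral_mult_right_zero) (simp only: 1 mult_1_right)
  finally show ?thesis .
qed

text \<open>\<open>erlang_density k\<close> has shape \<open>k + 1\<close>, so shape 0 is supplied
  separately, by the point mass at 0. It occurs for d = 1, when \<theta> is the only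
  eigenvalue.\<close>

lemma gamma_distribution_exists:
  obtains N where "real_distribution N" "AE s in N. 0 \<le> s" "integrable N (\<lambda>s. s)"
    "(LINT s|N. s) = real m" "\<And>l. l \<ge> 0 \<Longrightarrow> (LINT s|N. exp (- (l * s))) = 1 / (1 + l) ^ m"
proof (cases m)
  case 0
  interpret prob_space "return borel (0::real)" by (rule prob_space_return) simp
  have AE0: "AE s in return borel (0::real). s = 0" by (subst AE_return) auto
  have int: "(LINT s|return borel 0. f s) = f 0" if "f \<in> borel_measurable borel" for f :: "real \<Rightarrow> real"
    using that by (rule integral_return[rotated]) simp
  show ?thesis
  proof (rule that)
    show "real_distribution (return borel (0::real))"
      by unfold_locales simp
    show "integrable (return borel (0::real)) (\<lambda>s. s)"
      by (rule integrable_const_bound[of _ 0]) (use AE0 in auto)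
  qed (use AE0 in \<open>auto simp: int 0 elim!: eventually_mono\<close>)
next
  case (Suc k)
  let ?N = "density lborel (erlang_density k 1)"
  have nn: "AE s in ?N. 0 \<le> s"
    by (subst AE_density) (auto simp: erlang_density_def)
  have "has_bochner_integral ?N (\<lambda>s. s) (real m)"
  proof (rule has_bochner_integral_nn_integral)
    have "(\<integral>\<^sup>+s. ennreal s \<partial>?N) = (\<integral>\<^sup>+s. ennreal (erlang_density k 1 s) * ennreal s \<partial>lborel)"
      by (rule nn_integral_density) auto
    also have "\<dots> = (\<integral>\<^sup>+s. ennreal (erlang_density k 1 s * s ^ 1) \<partial>lborel)"
      by (intro nn_integral_cong) (simp add: ennreal_mult')
    also have "\<dots> = ennreal (real m)"
      by (subst nn_integral_erlang_ith_moment) (simp_all add: Suc)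
    finally show "(\<integral>\<^sup>+s. ennreal s \<partial>?N) = ennreal (real m)" .
  qed (use nn in auto)
  then show ?thesis
    using nn erlang_laplace[of _ k]
    by (intro that[of ?N] real_distribution_erlang)
      (auto simp: Suc has_bochner_integral_iff)
qed

lemma (in pair_sigma_finite) integral_mult_pair:
  fixes f g :: "_ \<Rightarrow> real"
  assumes f: "integrable M1 f" and g: "integrable M2 g"
  shows "integrable (M1 \<Otimes>\<^sub>M M2) (\<lambda>p. f (fst p) * g (snd p))"
    and "(\<integral>p. f (fst p) * g (snd p) \<partial>(M1 \<Otimes>\<^sub>M M2)) = (LINT x|M1. f x) * (LINT y|M2. g y)"
proof -
  have [measurable]: "f \<in> borel_measurable M1" "g \<in> borel_measurable M2" using f g by auto
  show 1: "integrable (M1 \<Otimes>\<^sub>M M2) (\<lambda>p. f (fst p) * g (snd p))"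
    by (rule Fubini_integrable) (use f g in \<open>auto simp: abs_mult\<close>)
  show "(\<integral>p. f (fst p) * g (snd p) \<partial>(M1 \<Otimes>\<^sub>M M2)) = (LINT x|M1. f x) * (LINT y|M2. g y)"
    unfolding integral_fst'[OF 1, symmetric] by simp
qed

text \<open>The integral is \<open>Gamma (1 - q) = Gamma (2 - q) / (1 - q)\<close>, and
  \<open>Gamma (2 - q) \<le> 1\<close> because \<open>x powr (1 - q)\<close> lies below an affine
  function of \<open>x\<close> with mean 1.\<close>

lemma integral_std_exponential_powr_neg_le:
  assumes q: "0 < q" "q < 1"
  shows "(LINT x|std_exponential. x powr - q) \<le> 1 / (1 - q)"
proof -
  interpret prob_space std_exponential by (rule prob_space_exponential_density) simp
  have G: "(LINT x|std_exponential. x powr (s - 1)) = Gamma s" if "s > 0" for s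
    using std_exponential_powr[OF that] by (rule has_bochner_integral_integral_eq)
  have 1: "(LINT x|std_exponential. x) = 1"
  proof -
    have "(LINT x|std_exponential. x) = (LINT x|std_exponential. x powr (2 - 1))"
      by (rule integral_cong_AE) (use AE_std_exponential_pos in \<open>auto elim!: eventually_mono\<close>)
    also have "\<dots> = 1" by (subst G) (simp_all add: Gamma_numeral)
    finally show ?thesis .
  qed
  have "Gamma (2 - q) = (LINT x|std_exponential. x powr (1 - q))"
    using G[of "2 - q"] q by simp
  also have "\<dots> \<le> (LINT x|std_exponential. 1 + (1 - q) * (x - 1))"
  proof (rule integral_mono_AE)
    show "integrable std_exponential (\<lambda>x. x powr (1 - q))"
      using std_exponential_powr[of "2 - q"] q by (auto intro: integrable.intros)
    show "AE x in std_exponential. x powr (1 - q) \<le> 1 + (1 - q) * (x - 1)"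
      using AE_std_exponential_pos by eventually_elim (use q in \<open>auto intro!: powr_le_affine\<close>)
  qed (use integrable_std_exponential in simp)
  also have "\<dots> = 1" using integrable_std_exponential 1 prob_space by simp
  finally have "Gamma (2 - q) \<le> 1" .
  moreover have "1 - q \<notin> \<int>\<^sub>\<le>\<^sub>0"
    using q by (auto elim!: nonpos_Ints_cases)
  then have "Gamma (2 - q) = (1 - q) * Gamma (1 - q)"
    using Gamma_plus1[of "1 - q"] by simp
  ultimately show ?thesis using G[of "1 - q"] q by (simp add: field_simps)
qed

text \<open>A sum of independent terms with the required transform is constructed, so that its
  logarithm can be estimated pointwise. The moments of order 1 and -1/2 are recorded for the upper
  and the lower growth bound respectively.\<close>

lemma mixture_distribution:
  fixes \<theta> :: real
  assumes d: "d \<ge> 1" and \<theta>: "\<theta> > real d"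
  obtains \<rho> where "real_distribution \<rho>" "AE x in \<rho>. x > 0"
    "\<And>l. l \<ge> 0 \<Longrightarrow> (LINT x|\<rho>. exp (- (l * x))) = 1 / ((1 + l) ^ (d - 1) * (1 + l * \<theta>))"
    "integrable \<rho> (\<lambda>x. x)" "integrable \<rho> ln" "integrable \<rho> (\<lambda>x. x powr - (1 / 2))"
    "\<bar>(LINT x|\<rho>. ln x) - (ln \<theta> - euler_mascheroni)\<bar> \<le> 16 * (real d / \<theta> * ln \<theta>)"
proof -
  define m where "m = d - 1"
  have \<theta>1: "\<theta> > 1" using d \<theta> by simp
  obtain N where N: "real_distribution N" and Npos: "AE s in N. 0 \<le> s" and iN: "integrable N (\<lambda>s. s)"
    and EN: "(LINT s|N. s) = real m" and LN: "\<And>l. l \<ge> 0 \<Longrightarrow> (LINT s|N. exp (- (l * s))) = 1 / (1 + l) ^ m"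
    by (rule gamma_distribution_exists[of m]) blast
  interpret E: real_distribution std_exponential by (rule real_distribution_erlang)
  interpret N: real_distribution N by (rule N)
  interpret EN: pair_prob_space std_exponential N ..
  let ?Q = "std_exponential \<Otimes>\<^sub>M N"
  let ?X = "\<lambda>p. \<theta> * fst p + snd p"
  have lift1: "integrable ?Q (\<lambda>p. f (fst p))" "(LINT p|?Q. f (fst p)) = (LINT x|std_exponential. f x)"
    if "integrable std_exponential f" for f :: "real \<Rightarrow> real"
    using EN.integral_mult_pair[OF that, of "\<lambda>_. 1"] N.prob_space by simp_all
  have lift2: "integrable ?Q (\<lambda>p. f (snd p))" if "integrable N f" for f :: "real \<Rightarrow> real"
    using EN.integral_mult_pair[OF _ that, of "\<lambda>_. 1"] by simp
  have mX [measurable]: "?X \<in> ?Q \<rightarrow>\<^sub>M borel" by measurable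
  have AEQ: "AE p in ?Q. fst p > 0 \<and> snd p \<ge> 0"
  proof -
    have "AE p in ?Q. fst p > 0"
    proof (rule iffD1[OF EN.AE_pair_iff[where P = "\<lambda>x s. x > 0"]])
      show "{p \<in> space ?Q. fst p > 0} \<in> sets ?Q" by measurable
    qed (use AE_std_exponential_pos in auto)
    moreover have "AE p in ?Q. snd p \<ge> 0"
    proof (rule iffD1[OF EN.AE_pair_iff[where P = "\<lambda>x s. s \<ge> 0"]])
      show "{p \<in> space ?Q. snd p \<ge> 0} \<in> sets ?Q" by measurable
    qed (use Npos in auto)
    ultimately show ?thesis by eventually_elim auto
  qed
  define \<rho> where "\<rho> = distr ?Q borel ?X"
  have rd: "real_distribution \<rho>"
    unfolding \<rho>_def by (rule EN.real_distribution_distr) measurable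
  have pos: "AE x in \<rho>. x > 0"
    unfolding \<rho>_def
  proof (subst AE_distr_iff)
    show "AE p in ?Q. 0 < ?X p"
      using AEQ by eventually_elim (use \<theta>1 in \<open>auto intro!: add_pos_nonneg\<close>)
  qed (use mX in auto)
  have lap: "(LINT x|\<rho>. exp (- (l * x))) = 1 / ((1 + l) ^ (d - 1) * (1 + l * \<theta>))" if l: "l \<ge> 0" for l
  proof -
    have lt: "l * \<theta> \<ge> 0" using l \<theta>1 by simp
    have "(LINT x|\<rho>. exp (- (l * x))) = (LINT p|?Q. exp (- (l * ?X p)))"
      unfolding \<rho>_def by (rule integral_distr) auto
    also have "\<dots> = (LINT p|?Q. exp (- (l * \<theta> * fst p)) * exp (- (l * snd p)))"
      by (simp add: exp_add[symmetric] algebra_simps)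
    also have "\<dots> = (LINT x|std_exponential. exp (- (l * \<theta> * x))) * (LINT s|N. exp (- (l * s)))"
    proof (rule EN.integral_mult_pair)
      show "integrable std_exponential (\<lambda>x. exp (- (l * \<theta> * x)))"
        by (rule E.integrable_const_bound[of _ 1])
          (use AE_std_exponential_pos lt in \<open>auto elim!: eventually_mono simp: mult_nonneg_nonneg\<close>)
      show "integrable N (\<lambda>s. exp (- (l * s)))"
        by (rule N.integrable_const_bound[of _ 1]) (use Npos l in \<open>auto elim!: eventually_mono\<close>)
    qed
    also have "\<dots> = 1 / ((1 + l) ^ (d - 1) * (1 + l * \<theta>))"
      using erlang_laplace[OF lt, of 0] LN[OF l] by (simp add: m_def)
    finally show ?thesis .
  qed
  have iX: "integrable ?Q ?X"
    using lift1[OF integrable_std_exponential] lift2[OF iN] by simp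
  have ilnx: "integrable ?Q (\<lambda>p. ln \<theta> + ln (fst p))"
    using lift1[OF integrable_ln_std_exponential] by simp
  have bounds: "AE p in ?Q. ln \<theta> + ln (fst p) \<le> ln (?X p) \<and> ln (?X p) \<le> ?X p
      \<and> ?X p powr - (1 / 2) \<le> fst p powr - (1 / 2)"
    using AEQ
  proof eventually_elim
    case (elim p)
    have t: "\<theta> * fst p \<ge> fst p" using elim \<theta>1 by simp
    have X: "?X p \<ge> fst p" using t elim by linarith
    have "ln \<theta> + ln (fst p) = ln (\<theta> * fst p)" using elim \<theta>1 by (simp add: ln_mult)
    also have "\<dots> \<le> ln (?X p)"
    proof (rule iffD2[OF ln_le_cancel_iff])
      show "\<theta> * fst p > 0" "?X p > 0" "\<theta> * fst p \<le> ?X p" using elim t by linarith+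
    qed
    finally have 1: "ln \<theta> + ln (fst p) \<le> ln (?X p)" .
    have "?X p > 0" using X elim by linarith
    then have "ln (?X p) \<le> ?X p" by (rule ln_bound)
    moreover have "?X p powr - (1 / 2) \<le> fst p powr - (1 / 2)"
      using X elim by (intro powr_mono2') auto
    ultimately show ?case using 1 by blast
  qed
  have ilnX: "integrable ?Q (\<lambda>p. ln (?X p))"
  proof (rule Bochner_Integration.integrable_bound)
    show "integrable ?Q (\<lambda>p. \<bar>ln \<theta> + ln (fst p)\<bar> + \<bar>?X p\<bar>)"
      by (rule Bochner_Integration.integrable_add[OF integrable_abs[OF ilnx] integrable_abs[OF iX]])
    show "AE p in ?Q. norm (ln (?X p)) \<le> norm (\<bar>ln \<theta> + ln (fst p)\<bar> + \<bar>?X p\<bar>)"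
      using bounds by eventually_elim auto
  qed measurable
  have ihalf: "integrable ?Q (\<lambda>p. ?X p powr - (1 / 2))"
  proof (rule Bochner_Integration.integrable_bound)
    have "integrable std_exponential (\<lambda>x. x powr - (1 / 2))"
      using std_exponential_powr[of "1 / 2"] by (auto intro: integrable.intros)
    then show "integrable ?Q (\<lambda>p. fst p powr - (1 / 2))" by (rule lift1)
    show "AE p in ?Q. norm (?X p powr - (1 / 2)) \<le> norm (fst p powr - (1 / 2))"
      using bounds by eventually_elim auto
  qed measurable
  have diff: "(LINT x|\<rho>. ln x) - (ln \<theta> - euler_mascheroni) = (LINT p|?Q. ln (?X p) - (ln \<theta> + ln (fst p)))"
  proof -
    have "(LINT x|\<rho>. ln x) = (LINT p|?Q. ln (?X p))"
      unfolding \<rho>_def by (rule integral_distr) auto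
    moreover have "(LINT p|?Q. ln \<theta> + ln (fst p)) = ln \<theta> - euler_mascheroni"
      using lift1[OF integrable_ln_std_exponential] EN.prob_space
      by (simp add: expectation_ln_std_exponential)
    ultimately show ?thesis using ilnX ilnx by simp
  qed
  \<comment> \<open>Dropping the nonnegative summand \<open>snd p\<close> can only decrease the
    logarithm, so the error has a sign.\<close>
  have lower: "0 \<le> (LINT p|?Q. ln (?X p) - (ln \<theta> + ln (fst p)))"
    by (rule integral_nonneg_AE) (use bounds in \<open>auto elim!: eventually_mono\<close>)
  have upper: "(LINT p|?Q. ln (?X p) - (ln \<theta> + ln (fst p))) \<le> 16 * (real d / \<theta> * ln \<theta>)"
  proof (cases "m = 0")
    \<comment> \<open>Here the summand \<open>snd p\<close> is nonnegative with mean 0, hence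
      vanishes almost surely, and the error is 0. The other case divides by
      \<open>m\<close>.\<close>
    case True
    have "AE s in N. s = 0"
      using integral_nonneg_eq_0_iff_AE[OF iN Npos] EN True by simp
    have "AE p in ?Q. snd p = 0"
    proof (rule iffD1[OF EN.AE_pair_iff[where P = "\<lambda>x s. s = 0"]])
      show "{p \<in> space ?Q. snd p = 0} \<in> sets ?Q" by measurable
    qed (use \<open>AE s in N. s = 0\<close> in auto)
    with AEQ have "AE p in ?Q. ln (?X p) - (ln \<theta> + ln (fst p)) = 0"
      by eventually_elim (use \<theta>1 in \<open>auto simp: ln_mult\<close>)
    then have "(LINT p|?Q. ln (?X p) - (ln \<theta> + ln (fst p))) = (LINT p|?Q. 0)"
      by (intro integral_cong_AE) auto
    then show ?thesis using \<theta>1 by simp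
  next
    case False
    then have d2: "d \<ge> 2" and m: "real m > 0" "real m < \<theta>" "real m \<ge> 1" "real m \<le> real d"
      using \<theta> by (auto simp: m_def)
    \<comment> \<open>This threshold is what makes \<open>\<delta> < 1 / 2\<close>, and therefore
      \<open>1 / q < 2\<close>, below.\<close>
    have ln\<theta>: "ln \<theta> > 1 / 2"
    proof -
      have "1 / 2 < ln (2::real)" using ln2_ge_two_thirds by simp
      also have "\<dots> < ln \<theta>" using d2 \<theta> by simp
      finally show ?thesis .
    qed
    \<comment> \<open>\<open>q\<close> balances the loss \<open>\<theta> powr (1 - q)\<close> against the moment \<open>Gamma (1 - q) \<le> 1 / (1 - q)\<close>.\<close>
    define \<delta> where "\<delta> = 1 / (4 * ln \<theta>)"
    define q where "q = 1 - \<delta>"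
    have \<delta>: "0 < \<delta>" "\<delta> < 1 / 2" "\<delta> * ln \<theta> = 1 / 4" using ln\<theta> by (auto simp: \<delta>_def field_simps)
    have q: "1 / 2 < q" "q < 1" using \<delta> by (auto simp: q_def)
    \<comment> \<open>An affine majorant of \<open>(s / real m) powr q\<close>, of mean 1 because
      \<open>s\<close> has mean \<open>m\<close>; only the first moment of the Gamma variable is
      spent.\<close>
    define G where "G s = 1 + q * (s / real m - 1)" for s
    have iG: "integrable N G" unfolding G_def using iN by simp
    have EG: "(LINT s|N. G s) = 1"
      unfolding G_def using iN EN N.prob_space m by simp
    have ip: "integrable std_exponential (\<lambda>x. x powr - q)"
      using std_exponential_powr[of "1 - q"] q by (auto intro: integrable.intros)
    define c where "c = (real m / \<theta>) powr q / q"
    have c0: "c \<ge> 0" using q by (simp add: c_def)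
    have "(LINT p|?Q. ln (?X p) - (ln \<theta> + ln (fst p))) \<le> (LINT p|?Q. c * (fst p powr - q * G (snd p)))"
    proof (rule integral_mono_AE)
      show "AE p in ?Q. ln (?X p) - (ln \<theta> + ln (fst p)) \<le> c * (fst p powr - q * G (snd p))"
        using AEQ
      proof eventually_elim
        case (elim p)
        then have x: "fst p > 0" and s: "snd p \<ge> 0" by auto
        define z where "z = snd p / (\<theta> * fst p)"
        have z: "z \<ge> 0" using x s \<theta>1 by (simp add: z_def)
        have "?X p = \<theta> * fst p * (1 + z)" using x \<theta>1 by (simp add: z_def field_simps)
        then have "ln (?X p) - (ln \<theta> + ln (fst p)) = ln (1 + z)"
          using x \<theta>1 z by (simp add: ln_mult)
        also have "\<dots> \<le> z powr q / q" using z q by (intro ln_one_plus_le_powr) auto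
        also have "z = (real m / \<theta>) * inverse (fst p) * (snd p / real m)"
          using m x by (simp add: z_def field_simps)
        also have "\<dots> powr q = (real m / \<theta>) powr q * fst p powr - q * (snd p / real m) powr q"
          using m x s \<theta>1 by (simp add: powr_mult powr_minus powr_divide inverse_powr)
        also have "\<dots> \<le> (real m / \<theta>) powr q * fst p powr - q * G (snd p)"
        proof (intro mult_left_mono)
          show "(snd p / real m) powr q \<le> G (snd p)"
            using s m q powr_le_affine[of "snd p / real m" q]
            by (cases "snd p = 0") (auto simp: G_def)
        qed simp
        finally show ?case using q by (simp add: c_def divide_right_mono mult.assoc)
      qed
      show "integrable ?Q (\<lambda>p. ln (?X p) - (ln \<theta> + ln (fst p)))" using ilnX ilnx by (rule Bochner_Integration.integrable_diff)
      show "integrable ?Q (\<lambda>p. c * (fst p powr - q * G (snd p)))"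
        by (intro integrable_mult_right EN.integral_mult_pair(1)[OF ip iG])
    qed
    also have "\<dots> = c * (LINT x|std_exponential. x powr - q)"
      using EN.integral_mult_pair(2)[OF ip iG] EG by simp
    also have "\<dots> \<le> c * (1 / (1 - q))"
      using q c0 by (intro mult_left_mono integral_std_exponential_powr_neg_le) auto
    also have "1 / (1 - q) = 4 * ln \<theta>" by (simp add: q_def \<delta>_def)
    \<comment> \<open>One factor 2 bounds \<open>\<theta> powr \<delta> = exp (1 / 4)\<close>,
      another one bounds \<open>1 / q\<close>; together with the 4 from \<open>1 / (1 - q)\<close>
      they make up the constant 16.\<close>
    also have "c * (4 * ln \<theta>) \<le> (4 * (real m / \<theta>)) * (4 * ln \<theta>)"
    proof (rule mult_right_mono)
      have eq: "(real m / \<theta>) powr q = real m / \<theta> * (\<theta> / real m) powr \<delta>"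
        using m \<theta>1 by (simp add: q_def powr_diff powr_divide)
      have "(\<theta> / real m) powr \<delta> \<le> \<theta> powr \<delta>"
        using m \<theta>1 \<delta> by (intro powr_mono2) (auto simp: field_simps)
      also have "\<theta> powr \<delta> = exp (1 / 4)" using \<theta>1 \<delta> by (simp add: powr_def)
      also have "exp (1 / 4 :: real) \<le> 2"
        using exp_bound[of "1 / 4 :: real"] by (simp add: power2_eq_square)
      finally have "(real m / \<theta>) powr q \<le> real m / \<theta> * 2"
        unfolding eq using m \<theta>1 by (intro mult_left_mono) auto
      moreover have "(real m / \<theta>) powr q / q \<le> (real m / \<theta>) powr q * 2"
        using q mult_left_mono[of 1 "2 * q" "(real m / \<theta>) powr q"] by (simp add: field_simps)
      ultimately show "c \<le> 4 * (real m / \<theta>)" by (simp add: c_def)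
    qed (use ln\<theta> in simp)
    also have "\<dots> = 16 * (real m / \<theta> * ln \<theta>)" by simp
    also have "\<dots> \<le> 16 * (real d / \<theta> * ln \<theta>)"
      using m \<theta>1 ln\<theta> by (intro mult_left_mono mult_right_mono divide_right_mono) auto
    finally show ?thesis .
  qed
  show ?thesis
  proof (rule that[OF rd pos lap])
    show "integrable \<rho> (\<lambda>x. x)" "integrable \<rho> ln" "integrable \<rho> (\<lambda>x. x powr - (1 / 2))"
      unfolding \<rho>_def using iX ilnX ihalf by (simp_all add: integrable_distr_eq)
    show "\<bar>(LINT x|\<rho>. ln x) - (ln \<theta> - euler_mascheroni)\<bar> \<le> 16 * (real d / \<theta> * ln \<theta>)"
      using diff lower upper by simp
  qed
qed

subsection \<open>Products of isotropic random matrices\<close>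

definition vec_sqnorm :: "complex vec \<Rightarrow> real" where
  "vec_sqnorm v = (\<Sum>i<dim_vec v. (cmod (vec_index v i))\<^sup>2)"

lemma vec_sqnorm_nonneg: "vec_sqnorm v \<ge> 0"
  by (simp add: vec_sqnorm_def sum_nonneg)

lemma vec_sqnorm_smult: "vec_sqnorm (c \<cdot>\<^sub>v v) = (cmod c)\<^sup>2 * vec_sqnorm v"
  by (simp add: vec_sqnorm_def norm_mult power_mult_distrib sum_distrib_left)

lemma vec_sqnorm_eq_0:
  assumes "v \<in> carrier_vec d" "vec_sqnorm v = 0"
  shows "v = 0\<^sub>v d"
  using assms by (intro eq_vecI) (auto simp: vec_sqnorm_def sum_nonneg_eq_0_iff)

lemma L2_set_vec: "L2_set (\<lambda>i. cmod (vec_index v i)) {..<dim_vec v} = sqrt (vec_sqnorm v)"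
  by (simp add: L2_set_def vec_sqnorm_def)

lemma vec_sqnorm_unit_vec: "j < d \<Longrightarrow> vec_sqnorm (unit_vec d j) = 1"
  by (simp add: vec_sqnorm_def unit_vec_def if_distrib[of cmod] if_distrib[of "\<lambda>x. x\<^sup>2"] cong: if_cong)

lemma mult_mat_unit_vec:
  fixes A :: "complex mat"
  assumes "A \<in> carrier_mat d d" "i < d" "j < d"
  shows "vec_index (A *\<^sub>v unit_vec d j) i = A $$ (i, j)"
  using assms by (simp add: scalar_prod_def unit_vec_def if_distrib cong: if_cong)

text \<open>Cauchy-Schwarz in each row bounds the image by the Hilbert-Schmidt norm, whose square is
  the sum of the squared column lengths.\<close>

lemma vec_sqnorm_mult_mat_le:
  fixes A :: "complex mat"
  assumes A: "A \<in> carrier_mat d d" and v: "v \<in> carrier_vec d" "vec_sqnorm v \<le> 1"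
  shows "vec_sqnorm (A *\<^sub>v v) \<le> (\<Sum>j<d. vec_sqnorm (A *\<^sub>v unit_vec d j))"
proof -
  have row: "(cmod (vec_index (A *\<^sub>v v) i))\<^sup>2 \<le> (\<Sum>j<d. (cmod (A $$ (i, j)))\<^sup>2)" if i: "i < d" for i
  proof -
    have "vec_index (A *\<^sub>v v) i = (\<Sum>j<d. A $$ (i, j) * vec_index v j)"
      using A v i by (auto simp: scalar_prod_def atLeast0LessThan intro!: sum.cong)
    then have "cmod (vec_index (A *\<^sub>v v) i) \<le> (\<Sum>j<d. \<bar>cmod (A $$ (i, j))\<bar> * \<bar>cmod (vec_index v j)\<bar>)"
      using norm_sum[of "\<lambda>j. A $$ (i, j) * vec_index v j" "{..<d}"] by (simp add: norm_mult)
    also have "\<dots> \<le> L2_set (\<lambda>j. cmod (A $$ (i, j))) {..<d} * L2_set (\<lambda>j. cmod (vec_index v j)) {..<d}"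
      by (rule L2_set_mult_ineq)
    also have "\<dots> \<le> L2_set (\<lambda>j. cmod (A $$ (i, j))) {..<d} * 1"
      using v by (intro mult_left_mono L2_set_nonneg) (auto simp: L2_set_def vec_sqnorm_def)
    finally have "(cmod (vec_index (A *\<^sub>v v) i))\<^sup>2 \<le> (L2_set (\<lambda>j. cmod (A $$ (i, j))) {..<d})\<^sup>2"
      by (intro power_mono) auto
    then show ?thesis by (simp add: L2_set_def sum_nonneg)
  qed
  have "vec_sqnorm (A *\<^sub>v v) \<le> (\<Sum>i<d. \<Sum>j<d. (cmod (A $$ (i, j)))\<^sup>2)"
    unfolding vec_sqnorm_def using A row by (auto intro!: sum_mono simp del: index_mult_mat_vec)
  also have "\<dots> = (\<Sum>j<d. vec_sqnorm (A *\<^sub>v unit_vec d j))"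
    using A by (subst sum.swap) (simp add: vec_sqnorm_def mult_mat_unit_vec del: index_mult_mat_vec)
  finally show ?thesis .
qed

text \<open>Reduces the norm to finitely many fixed vectors. The Hilbert-Schmidt bound also shows
  that the set under the real \<open>SUP\<close> is bounded above, without which the supremum need
  not dominate its members.\<close>

lemma op_norm_bounds:
  assumes A: "A \<in> carrier_mat d d"
  shows "op_norm A \<le> sqrt (\<Sum>j<d. vec_sqnorm (A *\<^sub>v unit_vec d j))"
    and "j < d \<Longrightarrow> sqrt (vec_sqnorm (A *\<^sub>v unit_vec d j)) \<le> op_norm A"
proof -
  define S where "S = {v \<in> carrier_vec d. sqrt (vec_sqnorm v) \<le> 1}"
  have op: "op_norm A = (SUP v\<in>S. sqrt (vec_sqnorm (A *\<^sub>v v)))"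
  proof -
    have "{v \<in> carrier_vec (dim_col A). L2_set (\<lambda>i. cmod (vec_index v i)) {..<dim_col A} \<le> 1} = S"
      unfolding S_def using A L2_set_vec by (metis (no_types, lifting) carrier_matD(2) carrier_vecD)
    moreover have "L2_set (\<lambda>i. cmod (vec_index (A *\<^sub>v v) i)) {..<dim_row A} = sqrt (vec_sqnorm (A *\<^sub>v v))" for v
      using L2_set_vec[of "A *\<^sub>v v"] by simp
    ultimately show ?thesis unfolding op_norm_def by simp
  qed
  have ub: "sqrt (vec_sqnorm (A *\<^sub>v v)) \<le> sqrt (\<Sum>j<d. vec_sqnorm (A *\<^sub>v unit_vec d j))" if "v \<in> S" for v
    using that by (auto simp: S_def intro!: vec_sqnorm_mult_mat_le[OF A])
  have "0\<^sub>v d \<in> S" by (simp add: S_def vec_sqnorm_def)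
  then show "op_norm A \<le> sqrt (\<Sum>j<d. vec_sqnorm (A *\<^sub>v unit_vec d j))"
    unfolding op using ub by (intro cSUP_least) auto
  have "bdd_above ((\<lambda>v. sqrt (vec_sqnorm (A *\<^sub>v v))) ` S)"
    using ub by (intro bdd_aboveI2)
  then show "sqrt (vec_sqnorm (A *\<^sub>v unit_vec d j)) \<le> op_norm A" if "j < d"
    unfolding op using that by (intro cSUP_upper) (auto simp: S_def vec_sqnorm_unit_vec)
qed

section \<open>Measurability of matrix products\<close>

lemma space_mat_borel: "space (mat_borel d) = carrier_mat d d"
  by (simp add: mat_borel_def)

lemma measurable_mat_borel_entry:
  assumes "i < d" "j < d"
  shows "(\<lambda>A. A $$ (i, j)) \<in> borel_measurable (mat_borel d)"
proof -
  have "(\<lambda>A. \<lambda>ij\<in>{..<d} \<times> {..<d}. A $$ ij) \<in> mat_borel d \<rightarrow>\<^sub>M Pi\<^sub>M ({..<d} \<times> {..<d}) (\<lambda>_. borel)"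
    unfolding mat_borel_def by (rule measurable_vimage_algebra1) (auto simp: space_PiM)
  from measurable_compose[OF this measurable_component_singleton[of "(i, j)"]] assms
  show ?thesis by simp
qed

lemma measurable_vec_sqnorm_mult:
  assumes entries: "\<And>i j. i < d \<Longrightarrow> j < d \<Longrightarrow> (\<lambda>x. F x $$ (i, j)) \<in> borel_measurable M"
    and F: "\<And>x. x \<in> space M \<Longrightarrow> F x \<in> carrier_mat d d" and v: "v \<in> carrier_vec d"
  shows "(\<lambda>x. vec_sqnorm (F x *\<^sub>v v)) \<in> borel_measurable M"
proof -
  have "vec_sqnorm (F x *\<^sub>v v) = (\<Sum>i<d. (cmod (\<Sum>j<d. F x $$ (i, j) * vec_index v j))\<^sup>2)"
    if "x \<in> space M" for x
    unfolding vec_sqnorm_def using F[OF that] v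
    by (auto simp: scalar_prod_def atLeast0LessThan intro!: sum.cong arg_cong[of _ _ cmod])
  moreover have "(\<lambda>x. \<Sum>i<d. (cmod (\<Sum>j<d. F x $$ (i, j) * vec_index v j))\<^sup>2) \<in> borel_measurable M"
    using entries
    by (intro borel_measurable_sum borel_measurable_power measurable_compose[OF _ borel_measurable_norm]
        borel_measurable_times borel_measurable_const) auto
  ultimately show ?thesis by (simp cong: measurable_cong)
qed

lemma mat_seq_prod_carrier:
  "(\<And>k. k < n \<Longrightarrow> \<omega> k \<in> carrier_mat d d) \<Longrightarrow> mat_seq_prod d \<omega> n \<in> carrier_mat d d"
  by (induction n) (auto intro!: mult_carrier_mat)

lemma mat_seq_prod_cong:
  "(\<And>k. k < n \<Longrightarrow> \<omega> k = \<omega>' k) \<Longrightarrow> mat_seq_prod d \<omega> n = mat_seq_prod d \<omega>' n"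
  by (induction n) auto

text \<open>The squared length of the image of a unit vector under one random factor has a law \<open>\<rho>\<close> that
  does not depend on the vector. Hence the squared length of \<open>P\<^sub>n v\<close> behaves like a product of \<open>n\<close>
  independent variables of law \<open>\<rho>\<close>.\<close>

locale isotropic_mats =
  fixes d :: nat and N :: "complex mat measure" and \<rho> :: "real measure"
  assumes d: "d \<ge> 1"
    and sets_N: "sets N = sets (mat_borel d)" and prob_N: "prob_space N"
    and rd: "real_distribution \<rho>" and pos: "AE x in \<rho>. x > 0"
    and int: "integrable \<rho> (\<lambda>x. x)" "integrable \<rho> ln" "integrable \<rho> (\<lambda>x. x powr - (1 / 2))"
    and law: "\<And>v. v \<in> carrier_vec d \<Longrightarrow> vec_sqnorm v = 1 \<Longrightarrow>
      distr N borel (\<lambda>A. vec_sqnorm (A *\<^sub>v v)) = \<rho>"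
begin

sublocale N: prob_space N by (rule prob_N)
sublocale \<rho>: real_distribution \<rho> by (rule rd)
sublocale PN: product_prob_space "\<lambda>_::nat. N" UNIV ..

lemma space_N: "space N = carrier_mat d d"
  using sets_eq_imp_space_eq[OF sets_N] by (simp add: space_mat_borel)

lemma measurable_entry: "i < d \<Longrightarrow> j < d \<Longrightarrow> (\<lambda>A. A $$ (i, j)) \<in> borel_measurable N"
  using measurable_mat_borel_entry[of i d j] by (simp cong: measurable_cong_sets add: measurable_cong_sets[OF sets_N refl])

text \<open>The convention \<open>0 powr t = 0\<close> makes this hold for \<open>w = 0\<close> too, and for \<open>t = 0\<close> it makes
  \<open>x powr t\<close> the indicator of \<open>x \<noteq> 0\<close>.\<close>

lemma nn_integral_step:
  assumes w: "w \<in> carrier_vec d"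
  shows "(\<integral>\<^sup>+A. ennreal (vec_sqnorm (A *\<^sub>v w) powr t) \<partial>N)
    = (\<integral>\<^sup>+x. ennreal (x powr t) \<partial>\<rho>) * ennreal (vec_sqnorm w powr t)"
proof (cases "vec_sqnorm w = 0")
  case True
  then have w0: "w = 0\<^sub>v d" by (rule vec_sqnorm_eq_0[OF w])
  have "vec_sqnorm (A *\<^sub>v w) = 0" if "A \<in> space N" for A
    using that by (auto simp: w0 space_N vec_sqnorm_def)
  then have "(\<integral>\<^sup>+A. ennreal (vec_sqnorm (A *\<^sub>v w) powr t) \<partial>N) = (\<integral>\<^sup>+A. 0 \<partial>N)"
    by (intro nn_integral_cong) simp
  then show ?thesis using True by simp
next
  case False
  then have p: "vec_sqnorm w > 0" using vec_sqnorm_nonneg[of w] by simp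
  define r where "r = sqrt (vec_sqnorm w)"
  have r: "r > 0" "r\<^sup>2 = vec_sqnorm w" using p by (auto simp: r_def)
  define v where "v = complex_of_real (1 / r) \<cdot>\<^sub>v w"
  have v: "v \<in> carrier_vec d" "vec_sqnorm v = 1"
    using w r p by (auto simp: v_def vec_sqnorm_smult norm_divide power_divide)
  have wv: "w = complex_of_real r \<cdot>\<^sub>v v" using r by (simp add: v_def smult_smult_assoc)
  have m: "(\<lambda>A. vec_sqnorm (A *\<^sub>v v)) \<in> borel_measurable N"
    by (rule measurable_vec_sqnorm_mult) (use measurable_entry space_N v in auto)
  have e: "vec_sqnorm (A *\<^sub>v w) = vec_sqnorm w * vec_sqnorm (A *\<^sub>v v)" if "A \<in> space N" for A
  proof -
    have "A *\<^sub>v w = complex_of_real r \<cdot>\<^sub>v (A *\<^sub>v v)"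
      unfolding wv using that v by (intro mult_mat_vec[of _ d d]) (auto simp: space_N)
    then show ?thesis using r by (simp add: vec_sqnorm_smult)
  qed
  have "(\<integral>\<^sup>+A. ennreal (vec_sqnorm (A *\<^sub>v w) powr t) \<partial>N)
      = (\<integral>\<^sup>+A. ennreal (vec_sqnorm w powr t) * ennreal (vec_sqnorm (A *\<^sub>v v) powr t) \<partial>N)"
    by (intro nn_integral_cong) (simp add: e powr_mult vec_sqnorm_nonneg ennreal_mult')
  also have "\<dots> = ennreal (vec_sqnorm w powr t) * (\<integral>\<^sup>+A. ennreal (vec_sqnorm (A *\<^sub>v v) powr t) \<partial>N)"
    using m by (intro nn_integral_cmult) simp
  also have "(\<integral>\<^sup>+A. ennreal (vec_sqnorm (A *\<^sub>v v) powr t) \<partial>N) = (\<integral>\<^sup>+x. ennreal (x powr t) \<partial>\<rho>)"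
    unfolding law[OF v, symmetric] by (subst nn_integral_distr[OF m]) auto
  finally show ?thesis by (simp add: mult.commute)
qed

lemma PiM_carrier: "\<omega> \<in> space (Pi\<^sub>M I (\<lambda>_. N)) \<Longrightarrow> i \<in> I \<Longrightarrow> \<omega> i \<in> carrier_mat d d"
  by (auto simp: space_PiM space_N)

lemma mat_seq_prod_carrier':
  "\<omega> \<in> space (Pi\<^sub>M I (\<lambda>_. N)) \<Longrightarrow> {..<n} \<subseteq> I \<Longrightarrow> mat_seq_prod d \<omega> n \<in> carrier_mat d d"
  by (rule mat_seq_prod_carrier) (auto intro: PiM_carrier)

lemma measurable_mat_seq_prod_entry:
  assumes "{..<n} \<subseteq> I" "i < d" "j < d"
  shows "(\<lambda>\<omega>. mat_seq_prod d \<omega> n $$ (i, j)) \<in> borel_measurable (Pi\<^sub>M I (\<lambda>_. N))"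
  using assms
proof (induction n arbitrary: i j)
  case (Suc n)
  have "mat_seq_prod d \<omega> (Suc n) $$ (i, j) = (\<Sum>l<d. \<omega> n $$ (i, l) * mat_seq_prod d \<omega> n $$ (l, j))"
    if "\<omega> \<in> space (Pi\<^sub>M I (\<lambda>_. N))" for \<omega>
  proof -
    have "\<omega> n \<in> carrier_mat d d" "mat_seq_prod d \<omega> n \<in> carrier_mat d d"
      using Suc.prems by (auto intro!: PiM_carrier[OF that] mat_seq_prod_carrier'[OF that])
    then show ?thesis
      using Suc.prems by (auto simp: scalar_prod_def atLeast0LessThan intro!: sum.cong)
  qed
  moreover have "(\<lambda>\<omega>. \<Sum>l<d. \<omega> n $$ (i, l) * mat_seq_prod d \<omega> n $$ (l, j)) \<in> borel_measurable (Pi\<^sub>M I (\<lambda>_. N))"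
  proof (intro borel_measurable_sum borel_measurable_times)
    fix l assume l: "l \<in> {..<d}"
    show "(\<lambda>\<omega>. \<omega> n $$ (i, l)) \<in> borel_measurable (Pi\<^sub>M I (\<lambda>_. N))"
      using Suc.prems l
      by (intro measurable_compose[OF measurable_component_singleton[of n I "\<lambda>_. N"] measurable_entry]) auto
    show "(\<lambda>\<omega>. mat_seq_prod d \<omega> n $$ (l, j)) \<in> borel_measurable (Pi\<^sub>M I (\<lambda>_. N))"
      using Suc.prems l by (intro Suc.IH) auto
  qed
  ultimately show ?case by (simp cong: measurable_cong)
qed simp

lemma measurable_sqnorm_process:
  assumes "{..<n} \<subseteq> I" "v \<in> carrier_vec d"
  shows "(\<lambda>\<omega>. vec_sqnorm (mat_seq_prod d \<omega> n *\<^sub>v v)) \<in> borel_measurable (Pi\<^sub>M I (\<lambda>_. N))"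
  by (rule measurable_vec_sqnorm_mult)
    (use assms in \<open>auto intro: measurable_mat_seq_prod_entry mat_seq_prod_carrier'\<close>)

text \<open>The newest factor multiplies from the left. Integrating over its coordinate
  \<open>n\<close> first therefore leaves the fixed vector
  \<open>mat_seq_prod d \<omega> n *\<^sub>v v\<close>, to which the one-step identity applies.
  Nonnegative integrals admit every real \<open>t\<close> before any moment is known to be
  finite.\<close>

lemma nn_integral_process_finite:
  assumes v: "v \<in> carrier_vec d"
  shows "(\<integral>\<^sup>+\<omega>. ennreal (vec_sqnorm (mat_seq_prod d \<omega> n *\<^sub>v v) powr t) \<partial>Pi\<^sub>M {..<n} (\<lambda>_. N))
    = (\<integral>\<^sup>+x. ennreal (x powr t) \<partial>\<rho>) ^ n * ennreal (vec_sqnorm v powr t)"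
proof (induction n)
  case 0
  have "prob_space (Pi\<^sub>M {..<0::nat} (\<lambda>_. N))" by (rule prob_space_PiM) (rule prob_N)
  then show ?case using v by (simp add: prob_space.emeasure_space_1)
next
  case (Suc n)
  let ?c = "\<integral>\<^sup>+x. ennreal (x powr t) \<partial>\<rho>"
  have "(\<integral>\<^sup>+\<omega>. ennreal (vec_sqnorm (mat_seq_prod d \<omega> (Suc n) *\<^sub>v v) powr t) \<partial>(Pi\<^sub>M {..<Suc n} (\<lambda>_. N)))
    = (\<integral>\<^sup>+\<omega>. (\<integral>\<^sup>+A. ennreal (vec_sqnorm (mat_seq_prod d (fun_upd \<omega> n A) (Suc n) *\<^sub>v v) powr t) \<partial>N) \<partial>(Pi\<^sub>M {..<n} (\<lambda>_. N)))"
    unfolding lessThan_Suc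
  proof (rule PN.product_nn_integral_insert)
    have "(\<lambda>\<omega>. vec_sqnorm (mat_seq_prod d \<omega> (Suc n) *\<^sub>v v)) \<in> borel_measurable (Pi\<^sub>M (insert n {..<n}) (\<lambda>_. N))"
      by (rule measurable_sqnorm_process) (use v in auto)
    then show "(\<lambda>\<omega>. ennreal (vec_sqnorm (mat_seq_prod d \<omega> (Suc n) *\<^sub>v v) powr t))
        \<in> borel_measurable (Pi\<^sub>M (insert n {..<n}) (\<lambda>_. N))" by simp
  qed auto
  also have "\<dots> = (\<integral>\<^sup>+\<omega>. ?c * ennreal (vec_sqnorm (mat_seq_prod d \<omega> n *\<^sub>v v) powr t) \<partial>Pi\<^sub>M {..<n} (\<lambda>_. N))"
  proof (intro nn_integral_cong)
    fix \<omega> assume \<omega>: "\<omega> \<in> space (Pi\<^sub>M {..<n} (\<lambda>_. N))"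
    have P: "mat_seq_prod d \<omega> n \<in> carrier_mat d d" by (rule mat_seq_prod_carrier'[OF \<omega>]) auto
    have "mat_seq_prod d (fun_upd \<omega> n A) (Suc n) *\<^sub>v v = A *\<^sub>v (mat_seq_prod d \<omega> n *\<^sub>v v)" if "A \<in> space N" for A
    proof -
      have "mat_seq_prod d (fun_upd \<omega> n A) n = mat_seq_prod d \<omega> n" by (rule mat_seq_prod_cong) simp
      then show ?thesis using that P v by (simp add: space_N assoc_mult_mat_vec[of _ d d _ d])
    qed
    then have "(\<integral>\<^sup>+A. ennreal (vec_sqnorm (mat_seq_prod d (fun_upd \<omega> n A) (Suc n) *\<^sub>v v) powr t) \<partial>N)
        = (\<integral>\<^sup>+A. ennreal (vec_sqnorm (A *\<^sub>v (mat_seq_prod d \<omega> n *\<^sub>v v)) powr t) \<partial>N)"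
      by (intro nn_integral_cong) simp
    also have "\<dots> = ?c * ennreal (vec_sqnorm (mat_seq_prod d \<omega> n *\<^sub>v v) powr t)"
      by (rule nn_integral_step) (use P v in auto)
    finally show "(\<integral>\<^sup>+A. ennreal (vec_sqnorm (mat_seq_prod d (fun_upd \<omega> n A) (Suc n) *\<^sub>v v) powr t) \<partial>N)
        = ?c * ennreal (vec_sqnorm (mat_seq_prod d \<omega> n *\<^sub>v v) powr t)" .
  qed
  also have "\<dots> = ?c * (\<integral>\<^sup>+\<omega>. ennreal (vec_sqnorm (mat_seq_prod d \<omega> n *\<^sub>v v) powr t) \<partial>Pi\<^sub>M {..<n} (\<lambda>_. N))"
    using measurable_sqnorm_process[OF order_refl v] by (intro nn_integral_cmult) simp
  finally show ?case by (simp add: Suc.IH mult.assoc)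
qed

text \<open>The product of \<open>n\<close> factors reads only the coordinates below
  \<open>n\<close>, so the infinite product measure may be replaced by its marginal.\<close>

lemma nn_integral_process:
  assumes v: "v \<in> carrier_vec d"
  shows "(\<integral>\<^sup>+\<omega>. ennreal (vec_sqnorm (mat_seq_prod d \<omega> n *\<^sub>v v) powr t) \<partial>Pi\<^sub>M UNIV (\<lambda>_. N))
    = (\<integral>\<^sup>+x. ennreal (x powr t) \<partial>\<rho>) ^ n * ennreal (vec_sqnorm v powr t)"
proof -
  have "(\<integral>\<^sup>+\<omega>. ennreal (vec_sqnorm (mat_seq_prod d \<omega> n *\<^sub>v v) powr t) \<partial>Pi\<^sub>M UNIV (\<lambda>_. N))
    = (\<integral>\<^sup>+\<omega>. ennreal (vec_sqnorm (mat_seq_prod d (restrict \<omega> {..<n}) n *\<^sub>v v) powr t) \<partial>Pi\<^sub>M UNIV (\<lambda>_. N))"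
    by (intro nn_integral_cong arg_cong[of _ _ ennreal] arg_cong2[of _ _ _ _ "(powr)"] arg_cong[of _ _ vec_sqnorm]
        arg_cong2[of _ _ _ _ "(*\<^sub>v)"] mat_seq_prod_cong refl) simp
  also have "\<dots> = (\<integral>\<^sup>+\<omega>. ennreal (vec_sqnorm (mat_seq_prod d \<omega> n *\<^sub>v v) powr t)
      \<partial>distr (Pi\<^sub>M UNIV (\<lambda>_. N)) (Pi\<^sub>M {..<n} (\<lambda>_. N)) (\<lambda>\<omega>. restrict \<omega> {..<n}))"
    using measurable_sqnorm_process[OF order_refl v]
    by (intro nn_integral_distr[symmetric] measurable_restrict_subset) auto
  also have "distr (Pi\<^sub>M UNIV (\<lambda>_. N)) (Pi\<^sub>M {..<n} (\<lambda>_. N)) (\<lambda>\<omega>. restrict \<omega> {..<n}) = Pi\<^sub>M {..<n} (\<lambda>_. N)"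
    by (rule PN.distr_PiM_restrict_finite) auto
  finally show ?thesis by (simp add: nn_integral_process_finite[OF v])
qed

text \<open>Markov's inequality bounds the exceptional probability by \<open>q ^ n\<close> with
  \<open>q = C * exp (- K) < 1\<close>, which is summable. The sign of \<open>t\<close> is left
  open: positive exponents yield upper, negative ones lower growth bounds.\<close>

lemma AE_eventually_powr_less:
  assumes v: "v \<in> carrier_vec d" "vec_sqnorm v = 1"
    and i: "integrable \<rho> (\<lambda>x. x powr t)" and K: "(LINT x|\<rho>. x powr t) < exp K"
  shows "AE \<omega> in Pi\<^sub>M UNIV (\<lambda>_. N).
    \<forall>\<^sub>F n in sequentially. vec_sqnorm (mat_seq_prod d \<omega> n *\<^sub>v v) powr t < exp (real n * K)"
proof -
  let ?M = "Pi\<^sub>M UNIV (\<lambda>_::nat. N)"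
  define X where "X n \<omega> = vec_sqnorm (mat_seq_prod d \<omega> n *\<^sub>v v) powr t" for n \<omega>
  have m [measurable]: "X n \<in> borel_measurable ?M" for n
    unfolding X_def using measurable_sqnorm_process[of n UNIV v] v by simp
  define C where "C = (LINT x|\<rho>. x powr t)"
  have C: "C \<ge> 0" unfolding C_def by (rule integral_nonneg_AE) simp
  have c: "(\<integral>\<^sup>+x. ennreal (x powr t) \<partial>\<rho>) = ennreal C"
    unfolding C_def by (rule nn_integral_eq_integral[OF i]) simp
  define q where "q = C * exp (- K)"
  have q: "0 \<le> q" "q < 1" using C K by (simp_all add: q_def C_def exp_minus field_simps)
  define A where "A n = {\<omega> \<in> space ?M. exp (real n * K) \<le> X n \<omega>}" for n
  have A [measurable]: "A n \<in> sets ?M" for n unfolding A_def by measurable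
  have "emeasure ?M (A n) \<le> ennreal (q ^ n)" for n
  proof -
    have "emeasure ?M (A n) = (\<integral>\<^sup>+\<omega>. indicator (A n) \<omega> \<partial>?M)" by simp
    also have "\<dots> \<le> (\<integral>\<^sup>+\<omega>. ennreal (exp (- (real n * K))) * ennreal (X n \<omega>) \<partial>?M)"
    proof (intro nn_integral_mono)
      fix \<omega>
      have "1 \<le> exp (- (real n * K)) * X n \<omega>" if "\<omega> \<in> A n"
        using that by (simp add: A_def exp_minus field_simps)
      then show "indicator (A n) \<omega> \<le> ennreal (exp (- (real n * K))) * ennreal (X n \<omega>)"
        by (auto simp: indicator_def X_def simp flip: ennreal_mult)
    qed
    also have "\<dots> = ennreal (exp (- (real n * K))) * (\<integral>\<^sup>+\<omega>. ennreal (X n \<omega>) \<partial>?M)"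
      by (intro nn_integral_cmult) simp
    also have "(\<integral>\<^sup>+\<omega>. ennreal (X n \<omega>) \<partial>?M) = ennreal (C ^ n)"
      unfolding X_def using nn_integral_process[OF v(1)] v(2) C by (simp add: c ennreal_power)
    also have "ennreal (exp (- (real n * K))) * ennreal (C ^ n) = ennreal (q ^ n)"
      using C by (simp add: q_def power_mult_distrib exp_of_nat_mult[symmetric] mult.commute flip: ennreal_mult)
    finally show ?thesis .
  qed
  then have meas: "measure ?M (A n) \<le> q ^ n" for n
    using q by (simp add: PN.P.emeasure_eq_measure)
  have "AE \<omega> in ?M. \<forall>\<^sub>F n in sequentially. \<omega> \<in> space ?M - A n"
  proof (rule borel_cantelli_AE1)
    show "summable (\<lambda>n. measure ?M (A n))"
      by (rule summable_comparison_test'[OF summable_geometric[of q], of 0]) (use q meas in auto)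
  qed (auto simp: PN.P.emeasure_finite less_top[symmetric])
  then show ?thesis
    by (rule eventually_mono) (auto simp: A_def X_def elim!: eventually_mono)
qed

text \<open>The moment of order 0 is the probability of a nonzero value; it is 1 for
  \<open>\<rho>\<close> and hence for every \<open>n\<close>. Since \<open>0 powr t = 0\<close>, a
  small negative moment does not by itself exclude the value 0, so the lower growth bound relies on
  this.\<close>

lemma AE_process_pos:
  assumes v: "v \<in> carrier_vec d" "vec_sqnorm v = 1"
  shows "AE \<omega> in Pi\<^sub>M UNIV (\<lambda>_. N). \<forall>n. vec_sqnorm (mat_seq_prod d \<omega> n *\<^sub>v v) > 0"
proof (subst AE_all_countable, intro allI)
  fix n
  let ?M = "Pi\<^sub>M UNIV (\<lambda>_::nat. N)"
  let ?X = "\<lambda>\<omega>. vec_sqnorm (mat_seq_prod d \<omega> n *\<^sub>v v)"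
  have m [measurable]: "?X \<in> borel_measurable ?M"
    using measurable_sqnorm_process[of n UNIV v] v by simp
  have "(\<integral>\<^sup>+x. ennreal (x powr 0) \<partial>\<rho>) = (\<integral>\<^sup>+x. 1 \<partial>\<rho>)"
    by (rule nn_integral_cong_AE) (use pos in \<open>auto elim!: eventually_mono\<close>)
  then have one: "(\<integral>\<^sup>+x. ennreal (x powr 0) \<partial>\<rho>) = 1" by (simp add: \<rho>.emeasure_space_1[unfolded \<rho>.space_eq_univ])
  have "emeasure ?M {\<omega> \<in> space ?M. ?X \<omega> \<noteq> 0} = (\<integral>\<^sup>+\<omega>. indicator {\<omega> \<in> space ?M. ?X \<omega> \<noteq> 0} \<omega> \<partial>?M)"
    by simp
  also have "\<dots> = (\<integral>\<^sup>+\<omega>. ennreal (?X \<omega> powr 0) \<partial>?M)"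
    by (intro nn_integral_cong) (auto simp: indicator_def)
  also have "\<dots> = 1" unfolding nn_integral_process[OF v(1)] one by (simp add: v)
  finally have "measure ?M {\<omega> \<in> space ?M. ?X \<omega> \<noteq> 0} = 1" by (simp add: PN.P.emeasure_eq_measure)
  then have "AE \<omega> in ?M. ?X \<omega> \<noteq> 0"
    by (subst PN.P.prob_Collect_eq_1[symmetric]) auto
  then show "AE \<omega> in ?M. ?X \<omega> > 0"
    by eventually_elim (use vec_sqnorm_nonneg in \<open>auto simp: less_le\<close>)
qed

lemma AE_growth_upper:
  assumes v: "v \<in> carrier_vec d" "vec_sqnorm v = 1" and K: "(LINT x|\<rho>. ln x) < K"
  shows "AE \<omega> in Pi\<^sub>M UNIV (\<lambda>_. N).
    \<forall>\<^sub>F n in sequentially. vec_sqnorm (mat_seq_prod d \<omega> n *\<^sub>v v) < exp (real n * K)"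
proof -
  obtain t where t: "0 < t" "t \<le> 1" "(LINT x|\<rho>. x powr t) < exp (t * K)"
    using \<rho>.expectation_powr_less_exp[OF pos int(1,2) K] by blast
  have "integrable \<rho> (\<lambda>x. x powr t)"
    by (rule \<rho>.integrable_powr_le_one[OF pos int(1)]) (use t in auto)
  from AE_eventually_powr_less[OF v this t(3)] show ?thesis
  proof eventually_elim
    case (elim \<omega>)
    then show ?case
    proof eventually_elim
      case (elim n)
      show ?case
      proof (rule ccontr)
        assume "\<not> ?thesis"
        then have "exp (real n * K) powr t \<le> vec_sqnorm (mat_seq_prod d \<omega> n *\<^sub>v v) powr t"
          using t by (intro powr_mono2) auto
        then show False using elim by (simp add: powr_def mult_ac)
      qed
    qed
  qed
qed

text \<open>The choice of exponent is made for \<open>x powr - (1 / 2)\<close>, whose logarithm is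
  \<open>- (1 / 2) * ln x\<close>. An exponent \<open>t \<le> 1\<close> there is the exponent
  \<open>- (t / 2)\<close> for \<open>x\<close>, within the range of finite negative
  moments.\<close>

lemma AE_growth_lower:
  assumes v: "v \<in> carrier_vec d" "vec_sqnorm v = 1" and K: "K < (LINT x|\<rho>. ln x)"
  shows "AE \<omega> in Pi\<^sub>M UNIV (\<lambda>_. N).
    \<forall>\<^sub>F n in sequentially. exp (real n * K) < vec_sqnorm (mat_seq_prod d \<omega> n *\<^sub>v v)"
proof -
  have pos': "AE x in \<rho>. x powr - (1 / 2) > 0"
    using pos by eventually_elim simp
  have ln': "AE x in \<rho>. - (1 / 2) * ln x = ln (x powr - (1 / 2))"
    using pos by eventually_elim (simp add: ln_powr)
  have i: "integrable \<rho> (\<lambda>x. - (1 / 2) * ln x)" using int(2) by simp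
  have i': "integrable \<rho> (\<lambda>x. ln (x powr - (1 / 2)))"
    by (rule integrable_cong_AE_imp[OF i]) (use ln' in \<open>auto elim!: eventually_mono\<close>)
  have "(LINT x|\<rho>. ln (x powr - (1 / 2))) = (LINT x|\<rho>. - (1 / 2) * ln x)"
    by (rule integral_cong_AE) (use ln' in \<open>auto elim!: eventually_mono\<close>)
  also have "\<dots> = - (1 / 2) * (LINT x|\<rho>. ln x)"
    by (rule integral_mult_right_zero)
  also have "\<dots> < - (1 / 2) * K" using K by simp
  finally obtain t where t: "0 < t" "t \<le> 1"
      "(LINT x|\<rho>. (x powr - (1 / 2)) powr t) < exp (t * (- (1 / 2) * K))"
    using \<rho>.expectation_powr_less_exp[OF pos' int(3) i'] by blast
  have "integrable \<rho> (\<lambda>x. (x powr - (1 / 2)) powr t)"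
    by (rule \<rho>.integrable_powr_le_one[OF pos' int(3)]) (use t in auto)
  then have it: "integrable \<rho> (\<lambda>x. x powr - (t / 2))"
    by (simp add: powr_powr)
  have "(LINT x|\<rho>. x powr - (t / 2)) < exp (- (t / 2) * K)"
    using t(3) by (simp add: powr_powr)
  from AE_eventually_powr_less[OF v it this] AE_process_pos[OF v] show ?thesis
  proof eventually_elim
    case (elim \<omega>)
    note p = elim(2)
    from elim(1) show ?case
    proof eventually_elim
      case (elim n)
      show ?case
      proof (rule ccontr)
        assume "\<not> ?thesis"
        then have "exp (real n * K) powr - (t / 2) \<le> vec_sqnorm (mat_seq_prod d \<omega> n *\<^sub>v v) powr - (t / 2)"
          using t p by (intro powr_mono2') auto
        then show False using elim by (simp add: powr_def mult_ac)
      qed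
    qed
  qed
qed

lemma AE_lyapunov:
  "AE \<omega> in Pi\<^sub>M UNIV (\<lambda>_. N).
    (\<lambda>n. ln (op_norm (mat_seq_prod d \<omega> n)) / real n) \<longlonglongrightarrow> (LINT x|\<rho>. ln x) / 2"
proof -
  let ?M = "Pi\<^sub>M UNIV (\<lambda>_::nat. N)"
  let ?X = "\<lambda>j n \<omega>. vec_sqnorm (mat_seq_prod d \<omega> n *\<^sub>v unit_vec d j)"
  define L where "L = (LINT x|\<rho>. ln x)"
  \<comment> \<open>Countably many margins, so that the exceptional sets unite to a null
    set.\<close>
  define \<epsilon> where "\<epsilon> k = inverse (real (Suc k))" for k
  have \<epsilon>: "\<epsilon> k > 0" for k by (simp add: \<epsilon>_def)
  have up: "AE \<omega> in ?M. \<forall>k. \<forall>j\<in>{..<d}. \<forall>\<^sub>F n in sequentially. ?X j n \<omega> < exp (real n * (L + \<epsilon> k))"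
    unfolding AE_all_countable AE_finite_all[OF finite_lessThan]
    by (intro allI ballI AE_growth_upper) (auto simp: vec_sqnorm_unit_vec \<epsilon> L_def[symmetric])
  have lo: "AE \<omega> in ?M. \<forall>k. \<forall>\<^sub>F n in sequentially. exp (real n * (L - \<epsilon> k)) < ?X 0 n \<omega>"
    unfolding AE_all_countable
    by (intro allI AE_growth_lower) (use d in \<open>auto simp: vec_sqnorm_unit_vec \<epsilon> L_def[symmetric]\<close>)
  from up lo AE_space show ?thesis
  proof eventually_elim
    case (elim \<omega>)
    have C: "mat_seq_prod d \<omega> n \<in> carrier_mat d d" for n
      by (rule mat_seq_prod_carrier'[OF elim(3)]) simp
    let ?a = "\<lambda>n. ln (op_norm (mat_seq_prod d \<omega> n)) / real n"
    have "\<forall>\<^sub>F n in sequentially. \<bar>?a n - L / 2\<bar> < e" if e: "e > 0" for e :: real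
    proof -
      obtain k where k: "\<epsilon> k < e" unfolding \<epsilon>_def using reals_Archimedean[OF e] by blast
      \<comment> \<open>Summing over \<open>d\<close> columns costs a factor \<open>sqrt d\<close>
        in the norm, which is lost after division by \<open>n\<close>.\<close>
      have "(\<lambda>n. ln (real d) / 2 / real n) \<longlonglongrightarrow> 0"
        by (rule lim_const_over_n)
      then have "\<forall>\<^sub>F n in sequentially. ln (real d) / 2 / real n < e / 2"
        using e by (intro order_tendstoD(2)[of _ 0]) auto
      moreover have "\<forall>\<^sub>F n in sequentially. \<forall>j\<in>{..<d}. ?X j n \<omega> < exp (real n * (L + \<epsilon> k))"
        using elim(1) by (subst eventually_ball_finite_distrib) auto
      moreover have "\<forall>\<^sub>F n in sequentially. exp (real n * (L - \<epsilon> k)) < ?X 0 n \<omega>"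
        using elim(2) by blast
      moreover have "\<forall>\<^sub>F n in sequentially. n > 0" by (rule eventually_gt_at_top)
      ultimately show ?thesis
      proof eventually_elim
        case (elim n)
        let ?o = "op_norm (mat_seq_prod d \<omega> n)"
        have n: "real n > 0" using elim by simp
        have "exp (real n * (L - \<epsilon> k) / 2) = sqrt (exp (real n * (L - \<epsilon> k)))"
          by (rule real_sqrt_unique[symmetric]) (simp_all add: power2_eq_square exp_add[symmetric])
        also have "\<dots> \<le> sqrt (?X 0 n \<omega>)" using elim by simp
        also have "\<dots> \<le> ?o" using op_norm_bounds(2)[OF C, of 0 n] d by simp
        finally have l: "exp (real n * (L - \<epsilon> k) / 2) \<le> ?o" .
        then have o: "?o > 0" using exp_gt_zero less_le_trans by blast
        have "real n * (L - \<epsilon> k) / 2 \<le> ln ?o" using ln_ge_iff[OF o] l by blast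
        then have lower: "L / 2 - \<epsilon> k / 2 \<le> ?a n" using n by (simp add: field_simps)
        have "?o \<le> sqrt (\<Sum>j<d. ?X j n \<omega>)" by (rule op_norm_bounds(1)[OF C])
        also have "\<dots> \<le> sqrt (\<Sum>j<d. exp (real n * (L + \<epsilon> k)))"
          using elim by (intro real_sqrt_le_mono sum_mono) (auto intro: less_imp_le)
        finally have "ln ?o \<le> ln (sqrt (real d * exp (real n * (L + \<epsilon> k))))"
          using o d by (subst ln_le_cancel_iff) auto
        also have "\<dots> = ln (real d) / 2 + real n * (L + \<epsilon> k) / 2"
          using d by (simp add: ln_sqrt ln_mult add_divide_distrib)
        finally have "?a n \<le> (ln (real d) / 2 + real n * (L + \<epsilon> k) / 2) / real n"
          using n by (intro divide_right_mono) auto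
        also have "\<dots> = ln (real d) / 2 / real n + L / 2 + \<epsilon> k / 2"
          using n by (simp add: field_simps)
        finally show ?case using lower elim(1) k e unfolding abs_less_iff by linarith
      qed
    qed
    then show ?case by (simp add: tendsto_iff dist_real_def L_def)
  qed
qed

end

subsection \<open>The law of one Gaussian factor\<close>

lemma measurable_into_mat_borel:
  assumes "\<And>x. x \<in> space M \<Longrightarrow> F x \<in> carrier_mat d d"
    and "\<And>i j. i < d \<Longrightarrow> j < d \<Longrightarrow> (\<lambda>x. F x $$ (i, j)) \<in> borel_measurable M"
  shows "F \<in> M \<rightarrow>\<^sub>M mat_borel d"
  unfolding mat_borel_def
  by (rule measurable_vimage_algebra2) (use assms in \<open>auto intro!: measurable_restrict\<close>)

lemma mult_mat_fun_entry:
  assumes "B \<in> carrier_mat d d" "i < d" "j < d"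
  shows "(B * mat d d g) $$ (i, j) = (\<Sum>l<d. B $$ (i, l) * g (l, j))"
  using assms by (subst mult_mat_entry[of _ d d _ d]) auto

lemma measurable_gaussian_mat:
  assumes B: "B \<in> carrier_mat d d"
  shows "(\<lambda>g. B * mat d d g) \<in> gaussian_vec ({..<d} \<times> {..<d}) \<rightarrow>\<^sub>M mat_borel d"
proof (rule measurable_into_mat_borel)
  fix i j assume ij: "i < d" "j < d"
  have "(\<lambda>g. (B * mat d d g) $$ (i, j)) = (\<lambda>g. \<Sum>l<d. B $$ (i, l) * g (l, j))"
    by (simp only: mult_mat_fun_entry[OF B ij])
  also have "\<dots> \<in> borel_measurable (gaussian_vec ({..<d} \<times> {..<d}))"
    using ij by (intro borel_measurable_sum borel_measurable_times borel_measurable_const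
        measurable_gaussian_vec_component) auto
  finally show "(\<lambda>g. (B * mat d d g) $$ (i, j)) \<in> borel_measurable (gaussian_vec ({..<d} \<times> {..<d}))" .
qed (use B in auto)

text \<open>The image of \<open>v\<close> is linear in the \<open>d * d\<close> independent entries.
  The adjoint of this linear map sends \<open>z\<close> to an outer product with the conjugate of
  \<open>v\<close>, so \<open>v\<close> enters only through its length 1. This is the source of
  isotropy.\<close>

lemma gaussian_mat_laplace:
  fixes u :: "nat \<Rightarrow> complex"
  assumes B: "B \<in> carrier_mat d d" and d: "d \<ge> 1" and \<theta>: "\<theta> > 1" and u: "(\<Sum>k<d. (cmod (u k))\<^sup>2) = 1"
    and gram: "\<And>k l. k < d \<Longrightarrow> l < d \<Longrightarrow>
      (\<Sum>j<d. B $$ (k, j) * cnj (B $$ (l, j))) = of_bool (k = l) + of_real (\<theta> - 1) * u k * cnj (u l)"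
    and v: "v \<in> carrier_vec d" "vec_sqnorm v = 1" and l: "l \<ge> 0"
  shows "(LINT g|gaussian_vec ({..<d} \<times> {..<d}). exp (- (l * vec_sqnorm (B * mat d d g *\<^sub>v v))))
    = 1 / ((1 + l) ^ (d - 1) * (1 + l * \<theta>))"
proof -
  let ?I = "{..<d} \<times> {..<d}"
  define K where "K k p = B $$ (k, fst p) * vec_index v (snd p)" for k p
  have 1: "vec_sqnorm (B * mat d d g *\<^sub>v v) = (\<Sum>k<d. (cmod (\<Sum>p\<in>?I. K k p * g p))\<^sup>2)" for g
  proof -
    have "vec_index (B * mat d d g *\<^sub>v v) k = (\<Sum>p\<in>?I. K k p * g p)" if k: "k < d" for k
    proof -
      have "vec_index (B * mat d d g *\<^sub>v v) k = (\<Sum>j<d. (B * mat d d g) $$ (k, j) * vec_index v j)"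
        by (rule mult_mat_vec_entry) (use B v k in auto)
      also have "\<dots> = (\<Sum>j<d. \<Sum>i<d. K k (i, j) * g (i, j))"
        by (intro sum.cong refl)
          (simp add: mult_mat_fun_entry[OF B k] sum_distrib_left sum_distrib_right K_def mult_ac del: index_mult_mat)
      also have "\<dots> = (\<Sum>p\<in>?I. K k p * g p)"
        by (subst sum.swap) (simp add: sum.cartesian_product case_prod_beta')
      finally show ?thesis .
    qed
    then show ?thesis using B by (simp add: vec_sqnorm_def del: index_mult_mat_vec)
  qed
  have v1: "(\<Sum>j<d. (cmod (vec_index v j))\<^sup>2) = 1" using v by (auto simp: vec_sqnorm_def)
  have 2: "(\<Sum>p\<in>?I. (cmod (\<Sum>k<d. cnj (K k p) * z k))\<^sup>2)
      = (\<Sum>k<d. (cmod (z k))\<^sup>2) + (\<theta> - 1) * (cmod (\<Sum>k<d. cnj (u k) * z k))\<^sup>2" for z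
  proof -
    define y where "y j = (\<Sum>k<d. cnj (B $$ (k, j)) * z k)" for j
    define s where "s = (\<Sum>k<d. cnj (u k) * z k)"
    have "(\<Sum>p\<in>?I. (cmod (\<Sum>k<d. cnj (K k p) * z k))\<^sup>2)
        = (\<Sum>i<d. \<Sum>j<d. (cmod (\<Sum>k<d. cnj (K k (i, j)) * z k))\<^sup>2)"
      by (simp add: sum.cartesian_product case_prod_beta')
    also have "\<dots> = (\<Sum>i<d. \<Sum>j<d. (cmod (y i))\<^sup>2 * (cmod (vec_index v j))\<^sup>2)"
    proof (intro sum.cong refl)
      fix i j
      have "(\<Sum>k<d. cnj (K k (i, j)) * z k) = y i * cnj (vec_index v j)"
        by (simp add: K_def y_def sum_distrib_left sum_distrib_right mult_ac)
      then show "(cmod (\<Sum>k<d. cnj (K k (i, j)) * z k))\<^sup>2 = (cmod (y i))\<^sup>2 * (cmod (vec_index v j))\<^sup>2"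
        by (simp add: norm_mult power_mult_distrib)
    qed
    also have "\<dots> = (\<Sum>j<d. (cmod (y j))\<^sup>2)"
      by (simp add: sum_distrib_left[symmetric] v1)
    finally have a: "(\<Sum>p\<in>?I. (cmod (\<Sum>k<d. cnj (K k p) * z k))\<^sup>2) = (\<Sum>j<d. (cmod (y j))\<^sup>2)" .
    \<comment> \<open>\<open>y\<close> is the adjoint of \<open>B\<close> applied to
      \<open>z\<close>; its squared length is the quadratic form of the Gram matrix of
      \<open>B\<close>.\<close>
    have "complex_of_real (\<Sum>j<d. (cmod (y j))\<^sup>2) = (\<Sum>j<d. y j * cnj (y j))"
      by (simp only: of_real_sum complex_norm_square)
    also have "\<dots> = (\<Sum>j<d. \<Sum>k<d. \<Sum>m<d. (z k * cnj (z m)) * (B $$ (m, j) * cnj (B $$ (k, j))))"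
      by (simp add: y_def sum_product mult_ac)
    also have "\<dots> = (\<Sum>k<d. \<Sum>m<d. \<Sum>j<d. (z k * cnj (z m)) * (B $$ (m, j) * cnj (B $$ (k, j))))"
      by (subst sum.swap) (intro sum.cong refl sum.swap)
    also have "\<dots> = (\<Sum>k<d. \<Sum>m<d. (z k * cnj (z m)) * (of_bool (m = k) + of_real (\<theta> - 1) * u m * cnj (u k)))"
      by (intro sum.cong refl) (simp add: sum_distrib_left[symmetric] gram)
    also have "\<dots> = (\<Sum>k<d. \<Sum>m<d. (if m = k then z k * cnj (z k) else 0)
        + of_real (\<theta> - 1) * ((cnj (u k) * z k) * cnj (cnj (u m) * z m)))"
      by (intro sum.cong refl) (auto simp: algebra_simps)
    also have "\<dots> = (\<Sum>k<d. z k * cnj (z k)) + of_real (\<theta> - 1) * (s * cnj s)"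
      by (simp add: sum.distrib sum_distrib_left[symmetric] s_def sum_product)
    also have "\<dots> = of_real ((\<Sum>k<d. (cmod (z k))\<^sup>2) + (\<theta> - 1) * (cmod s)\<^sup>2)"
      by (simp only: of_real_add of_real_sum of_real_mult complex_norm_square)
    finally show ?thesis unfolding a s_def by (simp only: of_real_eq_iff)
  qed
  show ?thesis
    unfolding 1 gaussian_laplace_adjoint[OF finite_cartesian_product[OF finite_lessThan finite_lessThan] finite_lessThan l] 2
    by (rule gaussian_laplace_rank_one[OF l d \<theta> u])
qed

lemma isotropic_complex_gaussian_mat:
  fixes \<theta> :: real
  assumes d: "d \<ge> 1" and \<theta>: "\<theta> > real d" and S: "pos_def_hermitian d S"
    and c: "char_poly S = (\<Prod>a \<leftarrow> replicate (d - 1) 1 @ [complex_of_real \<theta>]. [:- a, 1:])"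
  obtains \<rho> where "isotropic_mats d (complex_gaussian_mat d S) \<rho>"
    "\<bar>(LINT x|\<rho>. ln x) - (ln \<theta> - euler_mascheroni)\<bar> \<le> 16 * (real d / \<theta> * ln \<theta>)"
proof -
  let ?I = "{..<d} \<times> {..<d}" and ?B = "mat_sqrt S"
  have \<theta>1: "\<theta> > 1" using d \<theta> by simp
  obtain u where B: "?B \<in> carrier_mat d d" and u: "(\<Sum>k<d. (cmod (u k))\<^sup>2) = 1"
    and gram: "\<And>k l. k < d \<Longrightarrow> l < d \<Longrightarrow>
      (\<Sum>j<d. ?B $$ (k, j) * cnj (?B $$ (l, j))) = of_bool (k = l) + of_real (\<theta> - 1) * u k * cnj (u l)"
    by (rule mat_sqrt_gram[OF S d \<theta>1 c]) blast
  obtain \<rho> where \<rho>: "real_distribution \<rho>" "AE x in \<rho>. x > 0"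
    "\<And>l. l \<ge> 0 \<Longrightarrow> (LINT x|\<rho>. exp (- (l * x))) = 1 / ((1 + l) ^ (d - 1) * (1 + l * \<theta>))"
    "integrable \<rho> (\<lambda>x. x)" "integrable \<rho> ln" "integrable \<rho> (\<lambda>x. x powr - (1 / 2))"
    "\<bar>(LINT x|\<rho>. ln x) - (ln \<theta> - euler_mascheroni)\<bar> \<le> 16 * (real d / \<theta> * ln \<theta>)"
    by (rule mixture_distribution[OF d \<theta>]) blast
  interpret G: prob_space "gaussian_vec ?I" by (rule prob_space_gaussian_vec)
  note mB = measurable_gaussian_mat[OF B]
  have law: "distr (complex_gaussian_mat d S) borel (\<lambda>A. vec_sqnorm (A *\<^sub>v v)) = \<rho>"
    if v: "v \<in> carrier_vec d" "vec_sqnorm v = 1" for v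
  proof -
    have mv: "(\<lambda>A. vec_sqnorm (A *\<^sub>v v)) \<in> borel_measurable (mat_borel d)"
      by (rule measurable_vec_sqnorm_mult)
        (use v in \<open>auto simp: space_mat_borel intro: measurable_mat_borel_entry\<close>)
    let ?X = "\<lambda>g. vec_sqnorm (?B * mat d d g *\<^sub>v v)"
    have mX: "?X \<in> borel_measurable (gaussian_vec ?I)"
      using measurable_compose[OF mB mv] .
    have "distr (complex_gaussian_mat d S) borel (\<lambda>A. vec_sqnorm (A *\<^sub>v v)) = distr (gaussian_vec ?I) borel ?X"
      unfolding complex_gaussian_mat_def by (subst distr_distr[OF mv mB]) (simp add: comp_def)
    also have "\<dots> = \<rho>"
    proof (rule laplace_uniqueness)
      show "real_distribution (distr (gaussian_vec ?I) borel ?X)"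
        using mX by (rule G.real_distribution_distr)
      show "AE x in distr (gaussian_vec ?I) borel ?X. 0 \<le> x"
        using mX by (subst AE_distr_iff) (auto simp: vec_sqnorm_nonneg)
      show "AE x in \<rho>. 0 \<le> x" using \<rho>(2) by eventually_elim simp
      fix n :: nat
      have "(LINT x|distr (gaussian_vec ?I) borel ?X. exp (- (real n * x)))
          = (LINT g|gaussian_vec ?I. exp (- (real n * ?X g)))"
        by (rule integral_distr[OF mX]) simp
      also have "\<dots> = 1 / ((1 + real n) ^ (d - 1) * (1 + real n * \<theta>))"
        by (rule gaussian_mat_laplace[OF B d \<theta>1 u gram v]) auto
      also have "\<dots> = (LINT x|\<rho>. exp (- (real n * x)))"
        by (rule \<rho>(3)[symmetric]) simp
      finally show "(LINT x|distr (gaussian_vec ?I) borel ?X. exp (- (real n * x))) = (LINT x|\<rho>. exp (- (real n * x)))" .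
    qed (rule \<rho>(1))
    finally show ?thesis .
  qed
  have "isotropic_mats d (complex_gaussian_mat d S) \<rho>"
  proof (rule isotropic_mats.intro)
    show "prob_space (complex_gaussian_mat d S)"
      unfolding complex_gaussian_mat_def by (rule G.prob_space_distr[OF mB])
  qed (use d \<rho> law in \<open>auto simp: complex_gaussian_mat_def\<close>)
  from this \<rho>(7) show ?thesis by (rule that)
qed

text \<open>Independence with common marginal \<open>N\<close> means that the joint law of the
  sequence is the product measure, so almost sure statements about the canonical model pull back to
  every sample space.\<close>

lemma iid_mats_distr:
  assumes "iid_mats d N M A"
  shows "(\<lambda>\<omega> i. A i \<omega>) \<in> M \<rightarrow>\<^sub>M Pi\<^sub>M UNIV (\<lambda>_. mat_borel d)"
    and "distr M (Pi\<^sub>M UNIV (\<lambda>_. mat_borel d)) (\<lambda>\<omega> i. A i \<omega>) = Pi\<^sub>M UNIV (\<lambda>_. N)"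
proof -
  interpret prob_space M using assms by (simp add: iid_mats_def)
  have ind: "indep_vars (\<lambda>_. mat_borel d) A UNIV" and N: "\<And>i. distr M (mat_borel d) (A i) = N"
    using assms by (auto simp: iid_mats_def)
  have rv: "random_variable (mat_borel d) (A i)" for i
    using ind by (auto simp: indep_vars_def)
  have "(\<lambda>\<omega>. \<lambda>i\<in>UNIV. A i \<omega>) \<in> M \<rightarrow>\<^sub>M Pi\<^sub>M UNIV (\<lambda>_. mat_borel d)"
    by (rule measurable_restrict) (rule rv)
  then show "(\<lambda>\<omega> i. A i \<omega>) \<in> M \<rightarrow>\<^sub>M Pi\<^sub>M UNIV (\<lambda>_. mat_borel d)"
    by (simp add: restrict_def)
  show "distr M (Pi\<^sub>M UNIV (\<lambda>_. mat_borel d)) (\<lambda>\<omega> i. A i \<omega>) = Pi\<^sub>M UNIV (\<lambda>_. N)"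
    using indep_vars_iff_distr_eq_PiM[where I = UNIV and M' = "\<lambda>_. mat_borel d" and X = A] rv ind by (simp add: N restrict_def)
qed

theorem theorem1p5:
  "\<exists>C::real. C > 0 \<and>
     (\<forall>(d::nat) (\<theta>::real) (\<Sigma>::complex mat).
        d \<ge> 1 \<and> \<theta> > real d \<and> pos_def_hermitian d \<Sigma> \<and>
        char_poly \<Sigma> = (\<Prod>a \<leftarrow> replicate (d - 1) 1 @ [complex_of_real \<theta>]. [:- a, 1:])
        \<longrightarrow>
        (\<exists>\<mu>\<^sub>1::real.
           is_top_lyapunov d (canonical_space (complex_gaussian_mat d \<Sigma>)) (\<lambda>i \<omega>. \<omega> i) \<mu>\<^sub>1 \<and>
           (\<forall>(M::'w measure) A.
              iid_mats d (complex_gaussian_mat d \<Sigma>) M A \<longrightarrow> is_top_lyapunov d M A \<mu>\<^sub>1) \<and>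
           \<bar>2 * \<mu>\<^sub>1 - (ln \<theta> - euler_mascheroni)\<bar> \<le> C * (real d / \<theta> * ln \<theta>)))"
proof (rule exI[of _ 16], intro conjI allI impI)
  show "(0::real) < 16" by simp
  fix d :: nat and \<theta> :: real and \<Sigma> :: "complex mat"
  assume *: "d \<ge> 1 \<and> \<theta> > real d \<and> pos_def_hermitian d \<Sigma> \<and>
    char_poly \<Sigma> = (\<Prod>a \<leftarrow> replicate (d - 1) 1 @ [complex_of_real \<theta>]. [:- a, 1:])"
  let ?N = "complex_gaussian_mat d \<Sigma>"
  obtain \<rho> where iso: "isotropic_mats d ?N \<rho>"
    and bound: "\<bar>(LINT x|\<rho>. ln x) - (ln \<theta> - euler_mascheroni)\<bar> \<le> 16 * (real d / \<theta> * ln \<theta>)"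
    using isotropic_complex_gaussian_mat[of d \<theta> \<Sigma>] * by blast
  define \<mu> where "\<mu> = (LINT x|\<rho>. ln x) / 2"
  note lyap = isotropic_mats.AE_lyapunov[OF iso, folded \<mu>_def]
  show "\<exists>\<mu>\<^sub>1. is_top_lyapunov d (canonical_space ?N) (\<lambda>i \<omega>. \<omega> i) \<mu>\<^sub>1 \<and>
      (\<forall>(M::'w measure) A. iid_mats d ?N M A \<longrightarrow> is_top_lyapunov d M A \<mu>\<^sub>1) \<and>
      \<bar>2 * \<mu>\<^sub>1 - (ln \<theta> - euler_mascheroni)\<bar> \<le> 16 * (real d / \<theta> * ln \<theta>)"
  proof (intro exI[of _ \<mu>] conjI allI impI)
    show "is_top_lyapunov d (canonical_space ?N) (\<lambda>i \<omega>. \<omega> i) \<mu>"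
      unfolding is_top_lyapunov_def canonical_space_def by (rule lyap)
    show "is_top_lyapunov d M A \<mu>" if "iid_mats d ?N M A" for M :: "'w measure" and A
      unfolding is_top_lyapunov_def
      by (rule AE_distrD[OF iid_mats_distr(1)[OF that]]) (simp only: iid_mats_distr(2)[OF that] lyap)
    show "\<bar>2 * \<mu> - (ln \<theta> - euler_mascheroni)\<bar> \<le> 16 * (real d / \<theta> * ln \<theta>)"
      using bound by (simp add: \<mu>_def)
  qed
qed

end
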